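(* Let $\alpha$ and $\beta$ be two finite Blaschke products of positive degree and let $a,b\in\mathbb{C}$. A linear operator $A$ from $K_\alpha$ into $K_\beta$ belongs to $\mathscr{T}(\alpha,\beta)$ if and only if there are functions $\chi_{a,b}\in K_\alpha$ and $\psi_{a,b}\in K_\beta$ such that $$A-S_{\beta,b}\,A\,S_{\alpha,a}^{*}=\psi_{a,b}\otimes k_0^{\alpha}+k_0^{\beta}\otimes\chi_{a,b}.$$
   Context: $H^2$ is the Hardy space of the unit disk $\mathbb{D}$, viewed as a closed subspace of $L^2(\partial\mathbb{D})$ with its usual inner product $\langle\cdot,\cdot\rangle$ (normalized Lebesgue measure, linear in the first argument). For a finite Blaschke product $\alpha$, the model space is $K_\alpha=H^2\ominus\alpha H^2$; its dimension is the degree of $\alpha$ and all its functions are bounded. $P_\alpha$ denotes the orthogonal projection from $L^2(\partial\mathbb{D})$ onto $K_\alpha$. For $\varphi\in L^2(\partial\mathbb{D})$ the asymmetric truncated Toeplitz operator $A_\varphi^{\alpha,\beta}:K_\alpha\to K_\beta$ is $A_\varphi^{\alpha,\beta}f=P_\beta(\varphi f)$, and $\mathscr{T}(\alpha,\beta)$ is the set of all bounded $A_\varphi^{\alpha,\beta}$, $\varphi\in L^2(\partial\mathbb{D})$ (boundedness is automatic here since the spaces are finite-dimensional). The functions $k_0^\alpha(z)=1-\overline{\alpha(0)}\alpha(z)$ and $\widetilde{k}_0^\alpha(z)=\frac{\alpha(z)-\alpha(0)}{z}$ belong to $K_\alpha$. For vectors $f,g$, $f\otimes g$ is the operator $(f\otimes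 g)h=\langle h,g\rangle f$. The compressed shift on $K_\alpha$ is $S_\alpha f=P_\alpha(zf)$, and for $c\in\mathbb{C}$ the modified compressed shift is $S_{\alpha,c}=S_\alpha+c\,(k_0^\alpha\otimes\widetilde{k}_0^\alpha)$. The same notation is used with $\beta$ in place of $\alpha$. *)

theory Defs
  imports "HOL-Probability.Probability"
begin

definition circle_measure :: "complex measure" where
  "circle_measure =
     distr (uniform_measure lborel {0..2 * pi}) (restrict_space borel (sphere 0 1)) cis"

lemma measurable_cis_circle:
  "cis \<in> measurable (uniform_measure lborel {0..2 * pi}) (restrict_space borel (sphere 0 1))"
proof -
  have "cis \<in> borel_measurable borel"
    by (intro borel_measurable_continuous_onI continuous_intros)
  then show ?thesis
    by (intro measurable_restrict_space2) (auto simp: measurable_def)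
qed

lemma space_circle_measure [simp]: "space circle_measure = sphere 0 1"
  by (simp add: circle_measure_def space_restrict_space)

lemma prob_space_circle_measure: "prob_space circle_measure"
  unfolding circle_measure_def
  by (intro prob_space.prob_space_distr prob_space_uniform_measure measurable_cis_circle) auto

definition circle_eq :: "(complex \<Rightarrow> complex) \<Rightarrow> (complex \<Rightarrow> complex) \<Rightarrow> bool" where
  "circle_eq f g \<longleftrightarrow>
     f \<in> borel_measurable circle_measure \<and> g \<in> borel_measurable circle_measure \<and>
     (AE z in circle_measure. f z = g z)"

lemma part_equivp_circle_eq: "part_equivp circle_eq"
proof (rule part_equivpI)
  show "\<exists>f. circle_eq f f"
    by (rule exI[of _ "\<lambda>_. 0"]) (simp add: circle_eq_def)
  show "symp circle_eq"
    by (rule sympI) (auto simp: circle_eq_def eq_commute)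
  show "transp circle_eq"
  proof (rule transpI)
    fix f g h assume "circle_eq f g" "circle_eq g h"
    then show "circle_eq f h"
      unfolding circle_eq_def by (auto elim: AE_mp)
  qed
qed

text \<open>All a.e.-classes of measurable functions are admitted, not only the square-integrable ones,
  so that the product of two classes is always defined; \<open>L2\<close> below is a subset of this type.\<close>

quotient_type circle_fun = "complex \<Rightarrow> complex" / partial: circle_eq
  by (rule part_equivp_circle_eq)

instantiation circle_fun :: comm_ring_1
begin

lift_definition zero_circle_fun :: circle_fun is "\<lambda>_. 0"
  by (simp add: circle_eq_def)

lift_definition one_circle_fun :: circle_fun is "\<lambda>_. 1"
  by (simp add: circle_eq_def)

lift_definition plus_circle_fun :: "circle_fun \<Rightarrow> circle_fun \<Rightarrow> circle_fun"
  is "\<lambda>f g z. f z + g z"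
  unfolding circle_eq_def by (auto elim: AE_mp)

lift_definition minus_circle_fun :: "circle_fun \<Rightarrow> circle_fun \<Rightarrow> circle_fun"
  is "\<lambda>f g z. f z - g z"
  unfolding circle_eq_def by (auto elim: AE_mp)

lift_definition uminus_circle_fun :: "circle_fun \<Rightarrow> circle_fun"
  is "\<lambda>f z. - f z"
  unfolding circle_eq_def by (auto elim: AE_mp)

lift_definition times_circle_fun :: "circle_fun \<Rightarrow> circle_fun \<Rightarrow> circle_fun"
  is "\<lambda>f g z. f z * g z"
  unfolding circle_eq_def by (auto elim: AE_mp)

instance
proof
  show "(0 :: circle_fun) \<noteq> 1"
  proof
    assume "(0 :: circle_fun) = 1"
    then have "AE z in circle_measure. False"
      by transfer (simp add: circle_eq_def)
    then show False
      using prob_space.AE_False[OF prob_space_circle_measure] by blast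
  qed
qed (transfer; auto simp: circle_eq_def algebra_simps)+

end

lift_definition circle_scale :: "complex \<Rightarrow> circle_fun \<Rightarrow> circle_fun" (infixr \<open>*\<^sub>C\<close> 75)
  is "\<lambda>c f z. c * f z"
  unfolding circle_eq_def by (auto elim: AE_mp)

text \<open>The class of a concrete function. Only its values on the circle matter; a function that is
  not measurable there is sent to \<open>0\<close>, and all uses below are with measurable ones.\<close>

lift_definition on_circle :: "(complex \<Rightarrow> complex) \<Rightarrow> circle_fun"
  is "\<lambda>f. if f \<in> borel_measurable circle_measure then f else (\<lambda>_. 0)"
  by (simp add: circle_eq_def)

lift_definition square_integrable :: "circle_fun \<Rightarrow> bool"
  is "\<lambda>f. integrable circle_measure (\<lambda>z. (cmod (f z))\<^sup>2)"
proof -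
  fix f g assume "circle_eq f g"
  then show "integrable circle_measure (\<lambda>z. (cmod (f z))\<^sup>2) =
      integrable circle_measure (\<lambda>z. (cmod (g z))\<^sup>2)"
    unfolding circle_eq_def by (intro integrable_cong_AE) auto
qed

definition L2 :: "circle_fun set" where
  "L2 = {f. square_integrable f}"

lemma cnj_measurable: "cnj \<in> borel_measurable borel"
  by (intro borel_measurable_continuous_onI continuous_intros)

text \<open>Only meaningful on \<open>L2\<close>: the Bochner integral of a non-integrable function is \<open>0\<close>.\<close>

lift_definition L2_inner :: "circle_fun \<Rightarrow> circle_fun \<Rightarrow> complex" (\<open>\<langle>_, _\<rangle>\<close>)
  is "\<lambda>f g. \<integral>z. f z * cnj (g z) \<partial>circle_measure"
proof -
  fix f f' g g' assume "circle_eq f f'" "circle_eq g g'"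
  then show "(\<integral>z. f z * cnj (g z) \<partial>circle_measure) =
      (\<integral>z. f' z * cnj (g' z) \<partial>circle_measure)"
    unfolding circle_eq_def
    by (intro integral_cong_AE borel_measurable_times measurable_compose[OF _ cnj_measurable])
      (auto elim: AE_mp)
qed

definition L2_norm :: "circle_fun \<Rightarrow> real" where
  "L2_norm f = sqrt (Re \<langle>f, f\<rangle>)"

text \<open>The Hardy space as a subspace of \<open>L2\<close>: the Fourier coefficients of negative index vanish.\<close>

definition H2 :: "circle_fun set" where
  "H2 = {f \<in> L2. \<forall>k::int. k < 0 \<longrightarrow> \<langle>f, on_circle (\<lambda>z. z powi k)\<rangle> = 0}"

text \<open>Nothing is required of \<open>\<alpha>\<close> outside the closed unit disk. The zeros are listed with
  multiplicity.\<close>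

definition finite_blaschke :: "(complex \<Rightarrow> complex) \<Rightarrow> nat \<Rightarrow> bool" where
  "finite_blaschke \<alpha> n \<longleftrightarrow>
     (\<exists>\<gamma> ws. cmod \<gamma> = 1 \<and> length ws = n \<and> (\<forall>w\<in>set ws. cmod w < 1) \<and>
        (\<forall>z\<in>cball 0 1. \<alpha> z = \<gamma> * (\<Prod>w\<leftarrow>ws. (z - w) / (1 - cnj w * z))))"

definition model_space :: "(complex \<Rightarrow> complex) \<Rightarrow> circle_fun set" where
  "model_space \<alpha> = {f \<in> H2. \<forall>g\<in>H2. \<langle>f, on_circle \<alpha> * g\<rangle> = 0}"

definition orth_proj :: "circle_fun set \<Rightarrow> circle_fun \<Rightarrow> circle_fun" where
  "orth_proj K f = (THE g. g \<in> K \<and> (\<forall>h\<in>K. \<langle>f - g, h\<rangle> = 0))"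

definition hilbert_adjoint ::
    "circle_fun set \<Rightarrow> (circle_fun \<Rightarrow> circle_fun) \<Rightarrow> circle_fun \<Rightarrow> circle_fun" where
  "hilbert_adjoint K T g = (THE h. h \<in> K \<and> (\<forall>f\<in>K. \<langle>T f, g\<rangle> = \<langle>f, h\<rangle>))"

text \<open>Operators on a subspace \<open>K\<close> are extensional functions (\<open>undefined\<close> off \<open>K\<close>), so that two
  of them are equal in HOL iff they agree on \<open>K\<close>.\<close>

definition linear_operators ::
    "circle_fun set \<Rightarrow> circle_fun set \<Rightarrow> (circle_fun \<Rightarrow> circle_fun) set" where
  "linear_operators K L =
     {A \<in> K \<rightarrow>\<^sub>E L.
        (\<forall>f\<in>K. \<forall>g\<in>K. A (f + g) = A f + A g) \<and>
        (\<forall>c. \<forall>f\<in>K. A (c *\<^sub>C f) = c *\<^sub>C A f)}"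

definition bounded_on :: "circle_fun set \<Rightarrow> (circle_fun \<Rightarrow> circle_fun) \<Rightarrow> bool" where
  "bounded_on K A \<longleftrightarrow> (\<exists>C. \<forall>f\<in>K. L2_norm (A f) \<le> C * L2_norm f)"

definition att_operator ::
    "(complex \<Rightarrow> complex) \<Rightarrow> (complex \<Rightarrow> complex) \<Rightarrow> circle_fun \<Rightarrow> circle_fun \<Rightarrow> circle_fun" where
  "att_operator \<alpha> \<beta> \<phi> = (\<lambda>f\<in>model_space \<alpha>. orth_proj (model_space \<beta>) (\<phi> * f))"

definition att_operators ::
    "(complex \<Rightarrow> complex) \<Rightarrow> (complex \<Rightarrow> complex) \<Rightarrow> (circle_fun \<Rightarrow> circle_fun) set" where
  "att_operators \<alpha> \<beta> =
     {att_operator \<alpha> \<beta> \<phi> | \<phi>. \<phi> \<in> L2 \<and> bounded_on (model_space \<alpha>) (att_operator \<alpha> \<beta> \<phi>)}"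

definition kernel0 :: "(complex \<Rightarrow> complex) \<Rightarrow> circle_fun" where
  "kernel0 \<alpha> = on_circle (\<lambda>z. 1 - cnj (\<alpha> 0) * \<alpha> z)"

definition conj_kernel0 :: "(complex \<Rightarrow> complex) \<Rightarrow> circle_fun" where
  "conj_kernel0 \<alpha> = on_circle (\<lambda>z. (\<alpha> z - \<alpha> 0) / z)"

definition rank_one :: "circle_fun \<Rightarrow> circle_fun \<Rightarrow> circle_fun \<Rightarrow> circle_fun" where
  "rank_one f g h = \<langle>h, g\<rangle> *\<^sub>C f"

definition compressed_shift :: "(complex \<Rightarrow> complex) \<Rightarrow> circle_fun \<Rightarrow> circle_fun" where
  "compressed_shift \<alpha> f = orth_proj (model_space \<alpha>) (on_circle (\<lambda>z. z) * f)"

definition modified_shift ::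
    "(complex \<Rightarrow> complex) \<Rightarrow> complex \<Rightarrow> circle_fun \<Rightarrow> circle_fun" where
  "modified_shift \<alpha> c f =
     compressed_shift \<alpha> f + c *\<^sub>C rank_one (kernel0 \<alpha>) (conj_kernel0 \<alpha>) f"

end

theory Submission
  imports Defs
begin

text \<open>
  Let \<open>T f = (f - f 0) / z\<close> be the backward shift. On \<open>K\<^bsub>\<alpha>\<^esub>\<close> it is the adjoint of the compressed shift, so the
  assertion for \<open>a = b = 0\<close> concerns the displacement \<open>A - S A T\<close> with \<open>S\<close> the compressed shift of \<open>K\<^bsub>\<beta>\<^esub>\<close>.
  For other \<open>a\<close> and \<open>b\<close> the operator \<open>S A T\<close> changes by terms \<open>v \<otimes> k\<^sub>0\<close> and \<open>k\<^sub>0 \<otimes> u\<close>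
  only, which can be absorbed in the two functions (\<open>modified_displacement\<close>).

  If \<open>A\<close> has symbol \<open>\<phi>\<close>, multiplication by \<open>z\<close> in \<open>S\<close> cancels division by \<open>z\<close> in \<open>T\<close>, up to two
  defects of rank one: the subtraction of \<open>f 0\<close> in \<open>T\<close>, and the defect \<open>k\<^sub>0 \<otimes> (1 / z)\<close> when \<open>S\<close> is moved
  past the projection (\<open>compressed_shift_orth_proj\<close>). This gives the required form of the displacement
  (\<open>toeplitz_displacement\<close>).

  Conversely, given \<open>u\<close> and \<open>v\<close>, the symbol \<open>\<phi> = v + cnj u\<close> yields an operator with displacement
  \<open>v \<otimes> k\<^sub>0 + k\<^sub>0 \<otimes> u\<close>. The difference \<open>D\<close> of \<open>A\<close> and this operator satisfies \<open>D = S D T\<close>. Now \<open>T\<close> is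
  triangular with the conjugated zeros \<open>cnj w\<close> of \<open>\<alpha>\<close> on the diagonal, \<open>cmod w < 1\<close>, and \<open>S\<close> is a contraction;
  hence \<open>D = 0\<close> (\<open>no_nonzero_shift_invariant\<close>).

  The structure of the model spaces comes from one decomposition: splitting off a zero \<open>w\<close> of the Blaschke product
  splits off the line of the Cauchy kernel \<open>1 / (1 - cnj w z)\<close> (\<open>model_decompose\<close>). Induction on the list of zeros
  then shows that the functions in a model space are bounded multipliers of the Hardy space
  (\<open>model_multiplier\<close>), and that linear functionals on it are inner products (\<open>model_riesz\<close>), which provides the
  projection. Hardy space functions are handled solely through Fourier coefficients on the circle.
\<close>

section \<open>Classes of functions on the circle\<close>

lemma measurable_circle_continuous:
  fixes f :: "complex \<Rightarrow> complex"
  assumes "continuous_on (sphere 0 1) f"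
  shows "f \<in> borel_measurable circle_measure"
proof -
  have "f \<in> borel_measurable (restrict_space borel (sphere 0 1))"
    by (intro borel_measurable_continuous_on_restrict assms)
  moreover have "sets circle_measure = sets (restrict_space borel (sphere 0 1))"
    by (simp add: circle_measure_def)
  ultimately show ?thesis
    using measurable_cong_sets by blast
qed

lemma on_circle_cong:
  assumes "\<And>z. cmod z = 1 \<Longrightarrow> f z = g z"
  shows "on_circle f = on_circle g"
proof -
  have "f \<in> borel_measurable circle_measure \<longleftrightarrow> g \<in> borel_measurable circle_measure"
    by (rule measurable_cong) (simp add: assms)
  moreover have "AE z in circle_measure. f z = g z"
    by (rule AE_I2) (simp add: assms)
  ultimately show ?thesis
    by transfer (auto simp: circle_eq_def)
qed

lemma on_circle_times:
  assumes "continuous_on (sphere 0 1) f" "continuous_on (sphere 0 1) g"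
  shows "on_circle f * on_circle g = on_circle (\<lambda>z. f z * g z)"
proof -
  have "f \<in> borel_measurable circle_measure" "g \<in> borel_measurable circle_measure"
    using assms by (auto intro: measurable_circle_continuous)
  then show ?thesis
    by transfer (auto simp: circle_eq_def)
qed

lemma on_circle_diff:
  assumes "continuous_on (sphere 0 1) f" "continuous_on (sphere 0 1) g"
  shows "on_circle f - on_circle g = on_circle (\<lambda>z. f z - g z)"
proof -
  have "f \<in> borel_measurable circle_measure" "g \<in> borel_measurable circle_measure"
    using assms by (auto intro: measurable_circle_continuous)
  then show ?thesis
    by transfer (auto simp: circle_eq_def)
qed

lemma on_circle_scale:
  assumes "continuous_on (sphere 0 1) f"
  shows "c *\<^sub>C on_circle f = on_circle (\<lambda>z. c * f z)"
proof -
  have "f \<in> borel_measurable circle_measure"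
    using assms by (auto intro: measurable_circle_continuous)
  then show ?thesis
    by transfer (auto simp: circle_eq_def)
qed

lemma on_circle_1: "on_circle (\<lambda>_. 1) = 1"
  by transfer (auto simp: circle_eq_def)

text \<open>Scalars are turned into multiplication by constant classes, so that identities between
  classes become identities in a commutative ring.\<close>

lemma circle_scale_conv: "c *\<^sub>C f = (c *\<^sub>C 1) * f"
  by transfer (auto simp: circle_eq_def)

lemma circle_scale_simps:
  "c *\<^sub>C (f + g) = c *\<^sub>C f + c *\<^sub>C g" "c *\<^sub>C (f - g) = c *\<^sub>C f - c *\<^sub>C g"
  "(c + d) *\<^sub>C f = c *\<^sub>C f + d *\<^sub>C f" "(c - d) *\<^sub>C f = c *\<^sub>C f - d *\<^sub>C f"
  "c *\<^sub>C d *\<^sub>C f = (c * d) *\<^sub>C f" "f * (c *\<^sub>C g) = c *\<^sub>C (f * g)" "(c *\<^sub>C f) * g = c *\<^sub>C (f * g)"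
  by (transfer; auto simp: circle_eq_def algebra_simps)+

lemma circle_scale_triv [simp]:
  "1 *\<^sub>C f = f" "0 *\<^sub>C f = 0" "c *\<^sub>C 0 = 0" "(- c) *\<^sub>C f = - (c *\<^sub>C f)" "c *\<^sub>C (- f) = - (c *\<^sub>C f)"
  by (transfer; auto simp: circle_eq_def)+

lift_definition circle_cnj :: "circle_fun \<Rightarrow> circle_fun" is "\<lambda>f z. cnj (f z)"
  unfolding circle_eq_def
  by (auto intro: measurable_compose[OF _ cnj_measurable] elim: AE_mp)

lemma measurable_cnj_circle [measurable (raw)]:
  "f \<in> borel_measurable M \<Longrightarrow> (\<lambda>x. cnj (f x)) \<in> borel_measurable M"
  by (rule measurable_compose[OF _ cnj_measurable])

lemma circle_cnj_simps [simp]: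
  "circle_cnj (f * g) = circle_cnj f * circle_cnj g"
  "circle_cnj (f + g) = circle_cnj f + circle_cnj g"
  "circle_cnj (f - g) = circle_cnj f - circle_cnj g"
  "circle_cnj (- f) = - circle_cnj f"
  "circle_cnj (c *\<^sub>C f) = cnj c *\<^sub>C circle_cnj f"
  "circle_cnj (circle_cnj f) = f"
  "circle_cnj 1 = 1" "circle_cnj 0 = 0"
  by (transfer; auto simp: circle_eq_def intro: measurable_cnj_circle)+

lemma circle_cnj_on_circle:
  assumes "continuous_on (sphere 0 1) f"
  shows "circle_cnj (on_circle f) = on_circle (\<lambda>z. cnj (f z))"
proof -
  have "f \<in> borel_measurable circle_measure"
    using assms by (auto intro: measurable_circle_continuous)
  then show ?thesis
    by transfer (auto simp: circle_eq_def intro: measurable_cnj_circle)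
qed

text \<open>Bounded multipliers keep products inside \<open>L2\<close>. All functions in a model space of a finite Blaschke
  product are of this kind, and hence also the symbol constructed from \<open>u\<close> and \<open>v\<close> in the converse direction.\<close>

lift_definition ess_bounded :: "circle_fun \<Rightarrow> bool"
  is "\<lambda>f. \<exists>C. AE z in circle_measure. cmod (f z) \<le> C"
proof -
  fix f g assume "circle_eq f g"
  then have *: "AE z in circle_measure. f z = g z" by (simp add: circle_eq_def)
  have "(AE z in circle_measure. cmod (f z) \<le> C) = (AE z in circle_measure. cmod (g z) \<le> C)" for C
  proof
    show "AE z in circle_measure. cmod (g z) \<le> C" if "AE z in circle_measure. cmod (f z) \<le> C"
      using that * by eventually_elim auto
    show "AE z in circle_measure. cmod (f z) \<le> C" if "AE z in circle_measure. cmod (g z) \<le> C"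
      using that * by eventually_elim auto
  qed
  then show "(\<exists>C. AE z in circle_measure. cmod (f z) \<le> C) = (\<exists>C. AE z in circle_measure. cmod (g z) \<le> C)"
    by simp
qed

lemma ess_bounded_add: "ess_bounded f \<Longrightarrow> ess_bounded g \<Longrightarrow> ess_bounded (f + g)"
proof (transfer, elim exE)
  fix f g and C D :: real
  assume "AE z in circle_measure. cmod (f z) \<le> C" "AE z in circle_measure. cmod (g z) \<le> D"
  then have "AE z in circle_measure. cmod (f z + g z) \<le> C + D"
    by eventually_elim (meson add_mono norm_triangle_le)
  then show "\<exists>C. AE z in circle_measure. cmod (f z + g z) \<le> C" by blast
qed

lemma ess_bounded_times: "ess_bounded f \<Longrightarrow> ess_bounded g \<Longrightarrow> ess_bounded (f * g)"
proof (transfer, elim exE)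
  fix f g and C D :: real
  assume "AE z in circle_measure. cmod (f z) \<le> C" "AE z in circle_measure. cmod (g z) \<le> D"
  then have "AE z in circle_measure. cmod (f z * g z) \<le> \<bar>C\<bar> * \<bar>D\<bar>"
    by eventually_elim (auto simp: norm_mult intro!: mult_mono)
  then show "\<exists>C. AE z in circle_measure. cmod (f z * g z) \<le> C" by blast
qed

lemma ess_bounded_cnj: "ess_bounded f \<Longrightarrow> ess_bounded (circle_cnj f)"
  by transfer simp

lemma ess_bounded_on_circle:
  assumes "continuous_on (sphere 0 1) f"
  shows "ess_bounded (on_circle f)"
proof -
  have "compact (f ` sphere 0 1)"
    by (intro compact_continuous_image assms) auto
  then obtain C where "\<forall>x\<in>f ` sphere 0 1. cmod x \<le> C"
    using compact_imp_bounded bounded_iff by metis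
  then have "AE z in circle_measure. cmod (f z) \<le> C"
    by (intro AE_I2) auto
  moreover have "f \<in> borel_measurable circle_measure"
    by (intro measurable_circle_continuous assms)
  ultimately show ?thesis
    by transfer auto
qed

lemma ess_bounded_1: "ess_bounded 1"
  by transfer auto

lemma ess_bounded_scale: "ess_bounded f \<Longrightarrow> ess_bounded (c *\<^sub>C f)"
proof (transfer, elim exE)
  fix f C and c :: complex
  assume "AE z in circle_measure. cmod (f z) \<le> C"
  then have "AE z in circle_measure. cmod (c * f z) \<le> cmod c * C"
    by eventually_elim (simp add: norm_mult mult_left_mono)
  then show "\<exists>C. AE z in circle_measure. cmod (c * f z) \<le> C" by blast
qed

section \<open>The inner product\<close>

lemma L2_add: "f \<in> L2 \<Longrightarrow> g \<in> L2 \<Longrightarrow> f + g \<in> L2"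
  unfolding L2_def mem_Collect_eq
proof transfer
  fix f g assume "circle_eq f f" "circle_eq g g"
  then have [measurable]: "f \<in> borel_measurable circle_measure" "g \<in> borel_measurable circle_measure"
    by (auto simp: circle_eq_def)
  assume i: "integrable circle_measure (\<lambda>z. (cmod (f z))\<^sup>2)" "integrable circle_measure (\<lambda>z. (cmod (g z))\<^sup>2)"
  show "integrable circle_measure (\<lambda>z. (cmod (f z + g z))\<^sup>2)"
  proof (rule Bochner_Integration.integrable_bound)
    show "integrable circle_measure (\<lambda>z. 2 * (cmod (f z))\<^sup>2 + 2 * (cmod (g z))\<^sup>2)"
      using i by auto
    have "(cmod (x + y))\<^sup>2 \<le> 2 * (cmod x)\<^sup>2 + 2 * (cmod y)\<^sup>2" for x y
    proof -
      have "(cmod (x + y))\<^sup>2 \<le> (cmod x + cmod y)\<^sup>2"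
        by (intro power_mono norm_triangle_ineq) auto
      also have "\<dots> \<le> 2 * (cmod x)\<^sup>2 + 2 * (cmod y)\<^sup>2"
        using sum_squares_bound[of "cmod x" "cmod y"] by (simp add: power2_sum)
      finally show ?thesis .
    qed
    then show "AE z in circle_measure. norm ((cmod (f z + g z))\<^sup>2) \<le> norm (2 * (cmod (f z))\<^sup>2 + 2 * (cmod (g z))\<^sup>2)"
      by (intro AE_I2) simp
  qed measurable
qed

lemma L2_times: "ess_bounded h \<Longrightarrow> f \<in> L2 \<Longrightarrow> h * f \<in> L2"
  unfolding L2_def mem_Collect_eq
proof (transfer, elim exE)
  fix h f and C :: real assume "circle_eq h h" "circle_eq f f"
  then have [measurable]: "f \<in> borel_measurable circle_measure" "h \<in> borel_measurable circle_measure"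
    by (auto simp: circle_eq_def)
  assume i: "integrable circle_measure (\<lambda>z. (cmod (f z))\<^sup>2)"
    and C: "AE z in circle_measure. cmod (h z) \<le> C"
  show "integrable circle_measure (\<lambda>z. (cmod (h z * f z))\<^sup>2)"
  proof (rule Bochner_Integration.integrable_bound)
    show "integrable circle_measure (\<lambda>z. C\<^sup>2 * (cmod (f z))\<^sup>2)"
      using i by auto
    show "AE z in circle_measure. norm ((cmod (h z * f z))\<^sup>2) \<le> norm (C\<^sup>2 * (cmod (f z))\<^sup>2)"
      using C by eventually_elim (auto simp: norm_mult power_mult_distrib intro!: mult_right_mono power_mono)
  qed measurable
qed

lemma L2_1: "1 \<in> L2"
proof -
  interpret prob_space circle_measure by (rule prob_space_circle_measure)
  show ?thesis
    unfolding L2_def mem_Collect_eq by transfer simp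
qed

lemma L2_bounded: "ess_bounded f \<Longrightarrow> f \<in> L2"
  using L2_times[OF _ L2_1] by simp

lemma L2_scale: "f \<in> L2 \<Longrightarrow> c *\<^sub>C f \<in> L2"
  using L2_times[of "c *\<^sub>C 1" f] ess_bounded_scale[OF ess_bounded_1, of c]
  by (simp flip: circle_scale_conv)

lemma L2_diff: "f \<in> L2 \<Longrightarrow> g \<in> L2 \<Longrightarrow> f - g \<in> L2"
  using L2_add[of f "(- 1) *\<^sub>C g"] L2_scale[of g "- 1"] by simp

lemma L2_cnj: "f \<in> L2 \<Longrightarrow> circle_cnj f \<in> L2"
  unfolding L2_def mem_Collect_eq by transfer simp

text \<open>No integrability is required, because both sides are literally the same integral. Together with
  \<open>circle_cnj \<theta> * \<theta> = 1\<close> this replaces most computations with integrals below.\<close>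

lemma inner_times_left: "\<langle>h * f, g\<rangle> = \<langle>f, circle_cnj h * g\<rangle>"
  by transfer (simp add: ac_simps)

lemma inner_commute: "\<langle>f, g\<rangle> = cnj \<langle>g, f\<rangle>"
proof transfer
  fix f g :: "complex \<Rightarrow> complex"
  have "(\<integral>z. f z * cnj (g z) \<partial>circle_measure) = (\<integral>z. cnj (g z * cnj (f z)) \<partial>circle_measure)"
    by (simp add: mult.commute)
  also have "\<dots> = cnj (\<integral>z. g z * cnj (f z) \<partial>circle_measure)"
    by (rule Bochner_Integration.integral_cnj)
  finally show "(\<integral>z. f z * cnj (g z) \<partial>circle_measure) = cnj (\<integral>z. g z * cnj (f z) \<partial>circle_measure)" .
qed

lemma inner_scale_left: "\<langle>c *\<^sub>C f, g\<rangle> = c * \<langle>f, g\<rangle>"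
  by transfer (simp add: mult.assoc)

lemma inner_add_left:
  assumes "f \<in> L2" "f' \<in> L2" "g \<in> L2"
  shows "\<langle>f + f', g\<rangle> = \<langle>f, g\<rangle> + \<langle>f', g\<rangle>"
  using assms unfolding L2_def mem_Collect_eq
proof transfer
  have int: "integrable circle_measure (\<lambda>z. f z * cnj (g z))"
    if "circle_eq f f" "circle_eq g g" and i: "integrable circle_measure (\<lambda>z. (cmod (f z))\<^sup>2)"
      "integrable circle_measure (\<lambda>z. (cmod (g z))\<^sup>2)" for f g
  proof (rule Bochner_Integration.integrable_bound)
    have [measurable]: "f \<in> borel_measurable circle_measure" "g \<in> borel_measurable circle_measure"
      using that by (auto simp: circle_eq_def)
    show "integrable circle_measure (\<lambda>z. (cmod (f z))\<^sup>2 + (cmod (g z))\<^sup>2)"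
      using i by auto
    show "(\<lambda>z. f z * cnj (g z)) \<in> borel_measurable circle_measure" by measurable
    have "cmod x * cmod y \<le> (cmod x)\<^sup>2 + (cmod y)\<^sup>2" for x y
    proof -
      have "0 \<le> cmod x * cmod y" by simp
      then show ?thesis using sum_squares_bound[of "cmod x" "cmod y"] by linarith
    qed
    then show "AE z in circle_measure. norm (f z * cnj (g z)) \<le> norm ((cmod (f z))\<^sup>2 + (cmod (g z))\<^sup>2)"
      by (intro AE_I2) (simp add: norm_mult)
  qed
  fix f f' g
  assume "circle_eq f f" "circle_eq f' f'" "circle_eq g g"
    "integrable circle_measure (\<lambda>z. (cmod (f z))\<^sup>2)" "integrable circle_measure (\<lambda>z. (cmod (f' z))\<^sup>2)"
    "integrable circle_measure (\<lambda>z. (cmod (g z))\<^sup>2)"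
  then show "(\<integral>z. (f z + f' z) * cnj (g z) \<partial>circle_measure) =
      (\<integral>z. f z * cnj (g z) \<partial>circle_measure) + (\<integral>z. f' z * cnj (g z) \<partial>circle_measure)"
    using int[of f g] int[of f' g] by (simp add: distrib_right)
qed

lemma inner_diff_left:
  assumes "f \<in> L2" "f' \<in> L2" "g \<in> L2"
  shows "\<langle>f - f', g\<rangle> = \<langle>f, g\<rangle> - \<langle>f', g\<rangle>"
  using inner_add_left[of f "(- 1) *\<^sub>C f'" g] L2_scale[of f' "- 1"] inner_scale_left[of "- 1" f' g] assms
  by simp

lemma inner_zero_left [simp]: "\<langle>0, g\<rangle> = 0"
  using inner_scale_left[of 0 0 g] by simp

lemma inner_zero_right [simp]: "\<langle>g, 0\<rangle> = 0"
  using inner_commute[of g 0] by simp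

lemma inner_scale_right: "\<langle>f, c *\<^sub>C g\<rangle> = cnj c * \<langle>f, g\<rangle>"
  using inner_commute[of f "c *\<^sub>C g"] inner_commute[of f g] inner_scale_left[of c g f] by simp

lemma inner_add_right:
  assumes "f \<in> L2" "g \<in> L2" "g' \<in> L2"
  shows "\<langle>f, g + g'\<rangle> = \<langle>f, g\<rangle> + \<langle>f, g'\<rangle>"
  using inner_add_left[of g g' f] inner_commute[of f "g + g'"] inner_commute[of f g] inner_commute[of f g'] assms
  by simp

lemma inner_diff_right:
  assumes "f \<in> L2" "g \<in> L2" "g' \<in> L2"
  shows "\<langle>f, g - g'\<rangle> = \<langle>f, g\<rangle> - \<langle>f, g'\<rangle>"
  using inner_diff_left[of g g' f] inner_commute[of f "g - g'"] inner_commute[of f g] inner_commute[of f g'] assms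
  by simp

lemma integral_times_cnj_self:
  "(\<integral>z. f z * cnj (f z) \<partial>M) = of_real (\<integral>z. (cmod (f z))\<^sup>2 \<partial>M)"
  unfolding integral_complex_of_real[symmetric] by (simp only: complex_norm_square)

lemma inner_self: "\<langle>f, f\<rangle> = of_real ((L2_norm f)\<^sup>2)" "0 \<le> L2_norm f"
proof -
  have "\<langle>f, f\<rangle> = of_real (Re \<langle>f, f\<rangle>) \<and> Re \<langle>f, f\<rangle> \<ge> 0"
  proof transfer
    fix f :: "complex \<Rightarrow> complex"
    show "(\<integral>z. f z * cnj (f z) \<partial>circle_measure) = of_real (Re (\<integral>z. f z * cnj (f z) \<partial>circle_measure))
      \<and> 0 \<le> Re (\<integral>z. f z * cnj (f z) \<partial>circle_measure)"
      unfolding integral_times_cnj_self by (simp add: integral_nonneg_AE)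
  qed
  then show "\<langle>f, f\<rangle> = of_real ((L2_norm f)\<^sup>2)" "0 \<le> L2_norm f"
    by (auto simp: L2_norm_def)
qed

lemma inner_self_eq_0:
  assumes "f \<in> L2" "\<langle>f, f\<rangle> = 0"
  shows "f = 0"
  using assms unfolding L2_def mem_Collect_eq
proof transfer
  fix f assume f: "circle_eq f f" and i: "integrable circle_measure (\<lambda>z. (cmod (f z))\<^sup>2)"
    and 0: "(\<integral>z. f z * cnj (f z) \<partial>circle_measure) = 0"
  have "(\<integral>z. (cmod (f z))\<^sup>2 \<partial>circle_measure) = 0"
    using 0 unfolding integral_times_cnj_self by simp
  then have "AE z in circle_measure. (cmod (f z))\<^sup>2 = 0"
    using integral_nonneg_eq_0_iff_AE[OF i] by simp
  then show "circle_eq f (\<lambda>_. 0)"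
    using f by (auto simp: circle_eq_def)
qed

lemma L2_norm_times_le:
  assumes "ess_bounded h"
  shows "\<exists>C. \<forall>f\<in>L2. L2_norm (h * f) \<le> C * L2_norm f"
proof -
  have "\<exists>C\<ge>0. \<forall>f. square_integrable f \<longrightarrow> Re \<langle>h * f, h * f\<rangle> \<le> C\<^sup>2 * Re \<langle>f, f\<rangle>"
    using assms
  proof (transfer, elim exE)
    fix h :: "complex \<Rightarrow> complex" and C :: real
    assume "circle_eq h h" and C: "AE z in circle_measure. cmod (h z) \<le> C"
    then have [measurable]: "h \<in> borel_measurable circle_measure"
      by (simp add: circle_eq_def)
    have "(\<integral>z. (cmod (h z * f z))\<^sup>2 \<partial>circle_measure) \<le> \<bar>C\<bar>\<^sup>2 * (\<integral>z. (cmod (f z))\<^sup>2 \<partial>circle_measure)"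
      if "circle_eq f f" and i: "integrable circle_measure (\<lambda>z. (cmod (f z))\<^sup>2)" for f
    proof -
      have [measurable]: "f \<in> borel_measurable circle_measure"
        using that by (simp add: circle_eq_def)
      have "(\<integral>z. (cmod (h z * f z))\<^sup>2 \<partial>circle_measure) \<le> (\<integral>z. \<bar>C\<bar>\<^sup>2 * (cmod (f z))\<^sup>2 \<partial>circle_measure)"
      proof (rule integral_mono_AE')
        show "AE z in circle_measure. (cmod (h z * f z))\<^sup>2 \<le> \<bar>C\<bar>\<^sup>2 * (cmod (f z))\<^sup>2"
          using C by eventually_elim
            (auto simp: norm_mult power_mult_distrib intro!: mult_right_mono power_mono)
      qed (use i in auto)
      then show ?thesis by simp
    qed
    then show "\<exists>C\<ge>0. \<forall>f\<in>{f. circle_eq f f}. integrable circle_measure (\<lambda>z. (cmod (f z))\<^sup>2) \<longrightarrow>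
        Re (\<integral>z. h z * f z * cnj (h z * f z) \<partial>circle_measure)
        \<le> C\<^sup>2 * Re (\<integral>z. f z * cnj (f z) \<partial>circle_measure)"
      unfolding integral_times_cnj_self by (intro exI[of _ "\<bar>C\<bar>"]) auto
  qed
  then obtain C where "C \<ge> 0" and C: "\<And>f. square_integrable f \<Longrightarrow> Re \<langle>h * f, h * f\<rangle> \<le> C\<^sup>2 * Re \<langle>f, f\<rangle>"
    by blast
  have "L2_norm (h * f) \<le> C * L2_norm f" if "f \<in> L2" for f
  proof -
    have "L2_norm (h * f) \<le> sqrt (C\<^sup>2 * Re \<langle>f, f\<rangle>)"
      using C[of f] that unfolding L2_norm_def by (intro real_sqrt_le_mono) (simp add: L2_def)
    then show ?thesis
      using \<open>C \<ge> 0\<close> by (simp add: L2_norm_def real_sqrt_mult)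
  qed
  then show ?thesis by blast
qed

lemma inner_1_1: "\<langle>1, 1\<rangle> = 1"
proof -
  interpret prob_space circle_measure by (rule prob_space_circle_measure)
  show ?thesis using prob_space by transfer simp
qed

section \<open>Powers of the coordinate\<close>

text \<open>The trigonometric monomials; the Fourier coefficients of \<open>f\<close> are \<open>\<langle>f, zpow k\<rangle>\<close>, and
  \<open>\<langle>f, 1\<rangle>\<close> is the value at \<open>0\<close> of a Hardy space function \<open>f\<close>.\<close>

definition zpow :: "int \<Rightarrow> circle_fun" where
  "zpow k = on_circle (\<lambda>z. z powi k)"

lemma continuous_on_zpow: "continuous_on (sphere 0 1) (\<lambda>z::complex. z powi k)"
  by (intro continuous_intros) auto

lemma zpow_add: "zpow j * zpow k = zpow (j + k)"
  unfolding zpow_def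
  by (subst on_circle_times[OF continuous_on_zpow continuous_on_zpow], rule on_circle_cong)
    (subst power_int_add, auto)

lemma zpow_0 [simp]: "zpow 0 = 1"
  by (simp add: zpow_def on_circle_1)

lemma cnj_eq_inverse: "cmod z = 1 \<Longrightarrow> cnj z = inverse z"
  using complex_norm_square[of z] by (intro inverse_unique[symmetric]) simp

lemma zpow_cnj [simp]: "circle_cnj (zpow k) = zpow (- k)"
  unfolding zpow_def
  by (subst circle_cnj_on_circle[OF continuous_on_zpow], rule on_circle_cong)
    (auto simp: power_int_minus cnj_eq_inverse power_int_inverse)

lemma ess_bounded_zpow: "ess_bounded (zpow k)"
  unfolding zpow_def by (intro ess_bounded_on_circle continuous_on_zpow)

lemma inner_1_zpow:
  assumes "k \<noteq> 0"
  shows "\<langle>1, zpow k\<rangle> = 0"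
proof -
  have "(\<lambda>z. z powi k) \<in> borel_measurable circle_measure"
    by (rule measurable_circle_continuous[OF continuous_on_zpow])
  then have "\<langle>zpow k, 1\<rangle> = (\<integral>z. z powi k \<partial>circle_measure)"
    unfolding zpow_def by transfer simp
  also have "\<dots> = (\<integral>t. cis t powi k \<partial>uniform_measure lborel {0..2 * pi})"
    unfolding circle_measure_def
    by (rule integral_distr[OF measurable_cis_circle])
      (simp add: borel_measurable_continuous_on_restrict continuous_on_zpow)
  also have "uniform_measure lborel {0..2 * pi} =
      density lborel (\<lambda>t. ennreal (indicator {0..2 * pi} t / (2 * pi)))"
    unfolding uniform_measure_def
    by (intro density_cong AE_I2) (auto simp: indicator_def divide_ennreal simp flip: ennreal_1)
  also have "(\<integral>t. cis t powi k \<partial>\<dots>) =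
      (\<integral>t. (indicator {0..2 * pi} t / (2 * pi)) *\<^sub>R cis (of_int k * t) \<partial>lborel)"
    by (subst integral_density)
      (auto simp: cis_power_int intro!: borel_measurable_continuous_onI continuous_intros)
  also have "\<dots> = (\<integral>t. indicator {0..2 * pi} t *\<^sub>R (cis (of_int k * t) / of_real (2 * pi)) \<partial>lborel)"
    by (intro Bochner_Integration.integral_cong) (auto simp: indicator_def scaleR_conv_of_real)
  also have "\<dots> = exp (\<i> * of_int k * of_real (2 * pi)) / (2 * pi * \<i> * of_int k) -
      exp (\<i> * of_int k * of_real 0) / (2 * pi * \<i> * of_int k)"
  proof (rule integral_FTC_atLeastAtMost)
    fix t :: real
    have "((\<lambda>z. exp (\<i> * of_int k * z) / (2 * pi * \<i> * of_int k)) has_field_derivative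
        cis (of_int k * t) / of_real (2 * pi)) (at (of_real t))"
      using assms by (auto simp: cis_conv_exp mult.assoc intro!: derivative_eq_intros)
    then show "((\<lambda>t. exp (\<i> * of_int k * of_real t) / (2 * pi * \<i> * of_int k)) has_vector_derivative
        cis (of_int k * t) / of_real (2 * pi)) (at t within {0..2 * pi})"
      by (rule has_vector_derivative_real_field)
  qed (auto intro!: continuous_intros)
  also have "exp (\<i> * of_int k * of_real (2 * pi)) = cis (2 * pi * of_int k)"
    by (simp add: cis_conv_exp mult_ac)
  also have "\<dots> = 1"
    by simp
  finally have "\<langle>zpow k, 1\<rangle> = 0"
    by simp
  then show ?thesis
    using inner_commute[of 1 "zpow k"] by simp
qed

text \<open>The trivial estimate by the \<open>L\<^sup>1\<close> norm. Only uniformity in \<open>k\<close> matters: it excludes geometric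
  growth of the coefficients as \<open>k\<close> tends to \<open>-\<infinity>\<close>. For a class that is not integrable both integrals in
  the estimate are \<open>0\<close> by convention.\<close>

lemma inner_zpow_bounded: "\<exists>C. \<forall>k. cmod \<langle>f, zpow k\<rangle> \<le> C"
  unfolding zpow_def
proof transfer
  fix f :: "complex \<Rightarrow> complex"
  have "cmod (\<integral>z. f z * cnj (z powi k) \<partial>circle_measure) \<le> (\<integral>z. cmod (f z) \<partial>circle_measure)" for k
  proof -
    have "cmod (\<integral>z. f z * cnj (z powi k) \<partial>circle_measure) \<le>
        (\<integral>z. cmod (f z * cnj (z powi k)) \<partial>circle_measure)"
      by (rule integral_norm_bound)
    also have "\<dots> = (\<integral>z. cmod (f z) \<partial>circle_measure)"
      by (intro Bochner_Integration.integral_cong) (auto simp: norm_mult norm_power_int)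
    finally show ?thesis .
  qed
  moreover have "(\<lambda>z. z powi k) \<in> borel_measurable circle_measure" for k
    by (rule measurable_circle_continuous[OF continuous_on_zpow])
  ultimately show "\<exists>C. \<forall>k. cmod (\<integral>z. f z * cnj ((if (\<lambda>z. z powi k) \<in> borel_measurable circle_measure
      then (\<lambda>z. z powi k) else (\<lambda>_. 0)) z) \<partial>circle_measure) \<le> C"
    by auto
qed

section \<open>The Hardy space and its multipliers\<close>

lemma H2_iff: "f \<in> H2 \<longleftrightarrow> f \<in> L2 \<and> (\<forall>k<0. \<langle>f, zpow k\<rangle> = 0)"
  by (auto simp: H2_def zpow_def)

lemma zpow_L2 [simp]: "zpow k \<in> L2"
  by (intro L2_bounded ess_bounded_zpow)

lemma inner_zpow_times: "\<langle>zpow j * f, zpow k\<rangle> = \<langle>f, zpow (k - j)\<rangle>"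
  by (simp add: inner_times_left zpow_add)

lemma H2_L2: "f \<in> H2 \<Longrightarrow> f \<in> L2"
  by (simp add: H2_iff)

lemma H2_add: "f \<in> H2 \<Longrightarrow> g \<in> H2 \<Longrightarrow> f + g \<in> H2"
  by (simp add: H2_iff L2_add inner_add_left)

lemma H2_diff: "f \<in> H2 \<Longrightarrow> g \<in> H2 \<Longrightarrow> f - g \<in> H2"
  by (simp add: H2_iff L2_diff inner_diff_left)

lemma H2_scale: "f \<in> H2 \<Longrightarrow> c *\<^sub>C f \<in> H2"
  by (simp add: H2_iff L2_scale inner_scale_left)

lemma H2_1: "1 \<in> H2"
  by (simp add: H2_iff L2_1 inner_1_zpow)

lemma H2_shift: "f \<in> H2 \<Longrightarrow> zpow 1 * f \<in> H2"
  by (auto simp: H2_iff L2_times ess_bounded_zpow inner_zpow_times)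

definition cauchy_kernel :: "complex \<Rightarrow> circle_fun" where
  "cauchy_kernel w = on_circle (\<lambda>z. 1 / (1 - cnj w * z))"

definition blaschke_factor :: "complex \<Rightarrow> circle_fun" where
  "blaschke_factor w = on_circle (\<lambda>z. (z - w) / (1 - cnj w * z))"

lemma blaschke_factor_denominator:
  fixes w z :: complex
  assumes "cmod w < 1" "cmod z \<le> 1"
  shows "1 - cnj w * z \<noteq> 0"
proof
  assume "1 - cnj w * z = 0"
  then have "1 = cmod w * cmod z"
    by (metis complex_mod_cnj eq_iff_diff_eq_0 norm_mult norm_one)
  moreover have "cmod w * cmod z \<le> cmod w * 1"
    using assms by (intro mult_left_mono) auto
  ultimately show False using assms by simp
qed

context
  fixes w :: complex
  assumes w: "cmod w < 1"
begin

lemma continuous_cauchy_kernel: "continuous_on (sphere 0 1) (\<lambda>z. 1 / (1 - cnj w * z))"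
  using blaschke_factor_denominator[OF w] by (intro continuous_intros) auto

lemma cauchy_kernel_inverse: "(1 - cnj w *\<^sub>C zpow 1) * cauchy_kernel w = 1"
proof -
  have "(1 - cnj w *\<^sub>C zpow 1) * cauchy_kernel w = on_circle (\<lambda>z. (1 - cnj w * z) * (1 / (1 - cnj w * z)))"
    unfolding cauchy_kernel_def zpow_def on_circle_1[symmetric]
    by (simp add: on_circle_scale on_circle_diff on_circle_times continuous_cauchy_kernel continuous_intros)
  also have "\<dots> = on_circle (\<lambda>z. 1)"
    using blaschke_factor_denominator[OF w] by (intro on_circle_cong) auto
  finally show ?thesis by (simp add: on_circle_1)
qed

lemma blaschke_factor_eq: "blaschke_factor w = (zpow 1 - w *\<^sub>C 1) * cauchy_kernel w"
  unfolding cauchy_kernel_def zpow_def on_circle_1[symmetric] blaschke_factor_def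
  by (simp add: on_circle_scale on_circle_diff on_circle_times continuous_cauchy_kernel continuous_intros)

lemma ess_bounded_cauchy_kernel: "ess_bounded (cauchy_kernel w)"
  unfolding cauchy_kernel_def by (intro ess_bounded_on_circle continuous_cauchy_kernel)

lemma ess_bounded_blaschke_factor: "ess_bounded (blaschke_factor w)"
  unfolding blaschke_factor_def using blaschke_factor_denominator[OF w]
  by (intro ess_bounded_on_circle continuous_intros) auto

text \<open>On the circle \<open>cnj z = 1 / z\<close>, so each of these is an identity of rational functions in \<open>z\<close>,
  \<open>w\<close> and \<open>cnj w\<close>. The third and fourth ones serve to divide by a Blaschke factor within the Hardy
  space.\<close>

lemma circle_identities:
  "circle_cnj (blaschke_factor w) * blaschke_factor w = 1"
  "circle_cnj (blaschke_factor w) * cauchy_kernel w = zpow (- 1) * circle_cnj (cauchy_kernel w)"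
  "circle_cnj (blaschke_factor w) - w *\<^sub>C (zpow (- 1) * circle_cnj (blaschke_factor w)) = zpow (- 1) - cnj w *\<^sub>C 1"
  "blaschke_factor w * zpow (- 1) = (1 - w * cnj w) *\<^sub>C cauchy_kernel w - w *\<^sub>C zpow (- 1)"
  "blaschke_factor w * (1 - cnj w *\<^sub>C zpow 1) = zpow 1 - w *\<^sub>C 1"
proof -
  define u v x y c d where "u = cauchy_kernel w" and "v = circle_cnj u" and "x = zpow 1"
    and "y = zpow (- 1)" and "c = w *\<^sub>C (1 :: circle_fun)" and "d = cnj w *\<^sub>C (1 :: circle_fun)"
  have xy: "x * y = 1"
    by (simp add: x_def y_def zpow_add)
  have u: "(1 - d * x) * u = 1"
    using cauchy_kernel_inverse by (simp add: u_def x_def d_def circle_scale_simps)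
  have v: "(1 - c * y) * v = 1"
    using arg_cong[OF cauchy_kernel_inverse, of circle_cnj]
    by (simp add: u_def v_def y_def c_def circle_scale_simps)
  have m: "blaschke_factor w = (x - c) * u" "circle_cnj (blaschke_factor w) = (y - d) * v"
    by (simp_all add: blaschke_factor_eq u_def v_def x_def y_def c_def d_def)
  have cd: "c * f = w *\<^sub>C f" "d * f = cnj w *\<^sub>C f" for f
    by (simp_all add: c_def d_def flip: circle_scale_conv)
  have "(x - c) * v = x * ((1 - c * y) * v) + c * (x * y - 1) * v" "(y - d) * u = y * ((1 - d * x) * u) + d * (x * y - 1) * u"
    by (simp_all add: algebra_simps)
  then have xv: "(x - c) * v = x" and yu: "(y - d) * u = y"
    by (simp_all add: u v xy)
  have "(y - d) * v * ((x - c) * u) = ((x - c) * v) * ((y - d) * u)"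
    by (simp only: ac_simps)
  then have "(y - d) * v * ((x - c) * u) = 1"
    by (simp add: xv yu xy)
  then show "circle_cnj (blaschke_factor w) * blaschke_factor w = 1"
    unfolding m(2) unfolding m(1) .
  have "(y - d) * v * u = ((y - d) * u) * v"
    by (simp only: ac_simps)
  then have "(y - d) * v * u = y * v"
    by (simp add: yu)
  then show "circle_cnj (blaschke_factor w) * cauchy_kernel w = zpow (- 1) * circle_cnj (cauchy_kernel w)"
    by (simp add: m(2) flip: u_def v_def y_def)
  have "(y - d) * v - c * (y * ((y - d) * v)) = (y - d) * ((1 - c * y) * v)"
    by (simp add: algebra_simps)
  then have "(y - d) * v - c * (y * ((y - d) * v)) = y - d"
    by (simp add: v)
  then show "circle_cnj (blaschke_factor w) - w *\<^sub>C (zpow (- 1) * circle_cnj (blaschke_factor w)) = zpow (- 1) - cnj w *\<^sub>C 1"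
    by (simp add: m(2) cd flip: y_def d_def)
  have "(x - c) * u * y = (x * y) * u - c * ((y - d) * u) - c * d * u"
    by (simp add: algebra_simps)
  then have "(x - c) * u * y = (1 - c * d) * u - c * y"
    unfolding xy yu by (simp add: algebra_simps)
  then show "blaschke_factor w * zpow (- 1) = (1 - w * cnj w) *\<^sub>C cauchy_kernel w - w *\<^sub>C zpow (- 1)"
    by (simp add: m(1) cd circle_scale_simps left_diff_distrib mult.assoc flip: y_def u_def)
  have "(x - c) * u * (1 - d * x) = (x - c) * ((1 - d * x) * u)"
    by (simp only: ac_simps)
  then have "(x - c) * u * (1 - d * x) = x - c"
    by (simp add: u)
  then show "blaschke_factor w * (1 - cnj w *\<^sub>C zpow 1) = zpow 1 - w *\<^sub>C 1"
    by (simp add: m(1) cd flip: x_def c_def)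
qed

text \<open>If \<open>h = f / (1 - cnj w z)\<close>, then \<open>h - cnj w z h = f\<close> yields \<open>c k = cnj w * c (k - 1)\<close> for the Fourier
  coefficients \<open>c\<close> of \<open>h\<close> of negative index. Iterating towards \<open>-\<infinity>\<close> and using that the
  coefficients are bounded gives \<open>c k = 0\<close>.\<close>

lemma H2_cauchy_kernel:
  assumes f: "f \<in> H2"
  shows "cauchy_kernel w * f \<in> H2" "\<langle>cauchy_kernel w * f, 1\<rangle> = \<langle>f, 1\<rangle>"
proof -
  define h where "h = cauchy_kernel w * f"
  define c where "c k = \<langle>h, zpow k\<rangle>" for k
  have h: "h \<in> L2"
    unfolding h_def by (intro L2_times ess_bounded_cauchy_kernel H2_L2 f)
  have feq: "f = h - cnj w *\<^sub>C (zpow 1 * h)"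
    using cauchy_kernel_inverse unfolding h_def
    by (metis (no_types, opaque_lifting) circle_scale_simps(7) left_diff_distrib mult.assoc mult_1)
  have rec: "\<langle>f, zpow k\<rangle> = c k - cnj w * c (k - 1)" for k
    unfolding c_def
    by (subst feq) (simp add: inner_diff_left h L2_scale L2_times ess_bounded_zpow inner_scale_left inner_zpow_times)
  have step: "c k = cnj w * c (k - 1)" if "k < 0" for k
    using rec[of k] f that by (simp add: H2_iff)
  have iter: "c k = cnj w ^ j * c (k - int j)" if "k < 0" for k j
  proof (induction j)
    case (Suc j)
    then show ?case using step[of "k - int j"] that by (simp add: algebra_simps)
  qed simp
  obtain C where C: "cmod (c k) \<le> C" for k
    using inner_zpow_bounded[of h] unfolding c_def by blast
  have zero: "c k = 0" if "k < 0" for k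
  proof -
    have "cmod (c k) \<le> cmod w ^ j * C" for j
      using iter[OF that, of j] C[of "k - int j"] by (simp add: norm_mult norm_power mult_left_mono)
    moreover have "(\<lambda>j. cmod w ^ j * C) \<longlonglongrightarrow> 0 * C"
      using w by (intro tendsto_mult LIMSEQ_power_zero tendsto_const) auto
    ultimately have "cmod (c k) \<le> 0 * C"
      by (intro tendsto_lowerbound) auto
    then show ?thesis by simp
  qed
  show "cauchy_kernel w * f \<in> H2"
    using zero h unfolding h_def c_def by (auto simp: H2_iff)
  show "\<langle>cauchy_kernel w * f, 1\<rangle> = \<langle>f, 1\<rangle>"
    using rec[of 0] zero[of "- 1"] by (simp add: c_def h_def)
qed

lemma cauchy_kernel_H2: "cauchy_kernel w \<in> H2"
  using H2_cauchy_kernel[OF H2_1] by simp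

lemma H2_blaschke_factor:
  assumes f: "f \<in> H2"
  shows "blaschke_factor w * f \<in> H2" "\<langle>blaschke_factor w * f, 1\<rangle> = - w * \<langle>f, 1\<rangle>"
proof -
  have eq: "blaschke_factor w * f = zpow 1 * (cauchy_kernel w * f) - w *\<^sub>C (cauchy_kernel w * f)"
    by (simp add: blaschke_factor_eq circle_scale_simps left_diff_distrib mult.assoc)
  show "blaschke_factor w * f \<in> H2"
    unfolding eq by (intro H2_diff H2_scale H2_shift H2_cauchy_kernel f)
  have "\<langle>zpow 1 * (cauchy_kernel w * f), zpow 0\<rangle> = 0"
    using H2_cauchy_kernel[OF f] unfolding inner_zpow_times by (simp add: H2_iff)
  then show "\<langle>blaschke_factor w * f, 1\<rangle> = - w * \<langle>f, 1\<rangle>"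
    unfolding eq using H2_cauchy_kernel[OF f]
    by (simp add: inner_diff_left H2_L2 H2_scale H2_shift H2_1 inner_scale_left)
qed

text \<open>On the circle \<open>(cnj B) E = (cnj E) / z\<close>
  for the factor \<open>B\<close> and the kernel \<open>E\<close> at \<open>w\<close>; so the inner product is the Fourier coefficient of
  index \<open>-1\<close> of \<open>E g\<close>, which is in the Hardy space. In terms of evaluation at \<open>w\<close>: \<open>B g\<close> vanishes there.\<close>

lemma inner_cauchy_kernel_blaschke_factor:
  assumes "g \<in> H2"
  shows "\<langle>blaschke_factor w * g, cauchy_kernel w\<rangle> = 0"
proof -
  have "\<langle>blaschke_factor w * g, cauchy_kernel w\<rangle> = \<langle>cauchy_kernel w * g, zpow (- 1)\<rangle>"
    unfolding inner_times_left circle_identities by (simp only: mult.commute)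
  then show ?thesis
    using H2_cauchy_kernel[OF assms] by (simp add: H2_iff)
qed

lemma inner_cauchy_kernel_self: "\<langle>cauchy_kernel w, cauchy_kernel w\<rangle> \<noteq> 0"
proof
  assume "\<langle>cauchy_kernel w, cauchy_kernel w\<rangle> = 0"
  then have "cauchy_kernel w = 0"
    by (intro inner_self_eq_0 H2_L2 cauchy_kernel_H2)
  then show False
    using cauchy_kernel_inverse by simp
qed

text \<open>A Hardy space function vanishing at \<open>w\<close> is divisible by the Blaschke factor at \<open>w\<close>. The
  quotient \<open>h = r / B\<close> satisfies \<open>(1 - w / z) h = (1 / z - cnj w) r\<close>, so its coefficients of index below
  \<open>-1\<close> are multiples of the one of index \<open>-1\<close>, and that one is a multiple of \<open>r w = \<langle>r, E\<rangle>\<close> with \<open>E\<close> the Cauchy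
  kernel at \<open>w\<close>.\<close>

lemma H2_divide_blaschke_factor:
  assumes r: "r \<in> H2" and orth: "\<langle>r, cauchy_kernel w\<rangle> = 0"
  shows "circle_cnj (blaschke_factor w) * r \<in> H2"
proof -
  define h where "h = circle_cnj (blaschke_factor w) * r"
  have h: "h \<in> L2"
    unfolding h_def by (intro L2_times ess_bounded_cnj ess_bounded_blaschke_factor H2_L2 r)
  have eq: "h = w *\<^sub>C (zpow (- 1) * h) + (zpow (- 1) * r - cnj w *\<^sub>C r)"
  proof -
    have "h - w *\<^sub>C (zpow (- 1) * h) =
        (circle_cnj (blaschke_factor w) - w *\<^sub>C (zpow (- 1) * circle_cnj (blaschke_factor w))) * r"
      by (simp add: h_def circle_scale_simps left_diff_distrib mult.assoc)
    also have "\<dots> = zpow (- 1) * r - cnj w *\<^sub>C r"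
      unfolding circle_identities by (simp add: left_diff_distrib circle_scale_simps)
    finally show ?thesis by (simp add: algebra_simps)
  qed
  have "\<langle>h, zpow (- 1)\<rangle> = \<langle>r, (1 - w * cnj w) *\<^sub>C cauchy_kernel w - w *\<^sub>C zpow (- 1)\<rangle>"
    by (simp add: h_def inner_times_left circle_identities)
  also have "\<dots> = 0"
    using r[unfolded H2_iff] by (simp add: inner_diff_right H2_L2 cauchy_kernel_H2 L2_scale inner_scale_right orth)
  finally have start: "\<langle>h, zpow (- 1)\<rangle> = 0" .
  have down: "\<langle>h, zpow (- 1 - int j)\<rangle> = 0" for j
  proof (induction j)
    case (Suc j)
    define k where "k = - 1 - int (Suc j)"
    have "\<langle>h, zpow k\<rangle> = w * \<langle>h, zpow (k + 1)\<rangle> + (\<langle>r, zpow (k + 1)\<rangle> - cnj w * \<langle>r, zpow k\<rangle>)"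
      by (subst eq) (simp add: inner_add_left inner_diff_left inner_scale_left inner_zpow_times
        L2_add L2_diff L2_scale L2_times ess_bounded_zpow h H2_L2 r)
    moreover have "k + 1 < 0" "k < 0" "k + 1 = - 1 - int j"
      by (auto simp: k_def)
    ultimately have "\<langle>h, zpow k\<rangle> = 0"
      using r Suc by (simp add: H2_iff)
    then show ?case
      unfolding k_def .
  qed (use start in simp)
  have "\<langle>h, zpow k\<rangle> = 0" if "k < 0" for k
    using down[of "nat (- 1 - k)"] that by simp
  then show ?thesis
    using h by (simp add: H2_iff h_def)
qed

end

section \<open>Model spaces of finite Blaschke products\<close>

text \<open>The list form allows induction on the zeros.\<close>

fun blaschke_class :: "complex \<Rightarrow> complex list \<Rightarrow> circle_fun" where
  "blaschke_class \<gamma> [] = \<gamma> *\<^sub>C 1"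
| "blaschke_class \<gamma> (w # ws) = blaschke_factor w * blaschke_class \<gamma> ws"

definition blaschke_data :: "complex \<Rightarrow> complex list \<Rightarrow> bool" where
  "blaschke_data \<gamma> ws \<longleftrightarrow> cmod \<gamma> = 1 \<and> (\<forall>w\<in>set ws. cmod w < 1)"

lemma finite_blaschke_class:
  assumes "finite_blaschke \<alpha> n"
  obtains \<gamma> ws where "blaschke_data \<gamma> ws" "on_circle \<alpha> = blaschke_class \<gamma> ws"
    "\<alpha> 0 = \<gamma> * (\<Prod>w\<leftarrow>ws. - w)" "continuous_on (sphere 0 1) \<alpha>"
proof -
  obtain \<gamma> ws where 1: "cmod \<gamma> = 1" and ws: "\<forall>w\<in>set ws. cmod w < 1"
    and \<alpha>: "\<And>z. z \<in> cball 0 1 \<Longrightarrow> \<alpha> z = \<gamma> * (\<Prod>w\<leftarrow>ws. (z - w) / (1 - cnj w * z))"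
    using assms unfolding finite_blaschke_def by blast
  have cont: "continuous_on (sphere 0 1) (\<lambda>z. \<gamma> * (\<Prod>w\<leftarrow>vs. (z - w) / (1 - cnj w * z)))"
    if "\<forall>w\<in>set vs. cmod w < 1" for vs
    using that
  proof (induction vs)
    case (Cons w vs)
    have "continuous_on (sphere 0 1) (\<lambda>z. (z - w) / (1 - cnj w * z))"
      using blaschke_factor_denominator[of w] Cons.prems by (intro continuous_intros) auto
    from continuous_on_mult[OF this Cons.IH] Cons.prems
    show ?case by (simp add: mult_ac)
  qed simp
  have "on_circle (\<lambda>z. \<gamma> * (\<Prod>w\<leftarrow>vs. (z - w) / (1 - cnj w * z))) = blaschke_class \<gamma> vs"
    if "\<forall>w\<in>set vs. cmod w < 1" for vs
    using that
  proof (induction vs)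
    case Nil
    show ?case
      using on_circle_scale[of "\<lambda>_. 1" \<gamma>] by (simp add: on_circle_1)
  next
    case (Cons w vs)
    have "continuous_on (sphere 0 1) (\<lambda>z. (z - w) / (1 - cnj w * z))"
      using blaschke_factor_denominator[of w] Cons.prems by (intro continuous_intros) auto
    then have "blaschke_factor w * blaschke_class \<gamma> vs =
        on_circle (\<lambda>z. (z - w) / (1 - cnj w * z) * (\<gamma> * (\<Prod>w\<leftarrow>vs. (z - w) / (1 - cnj w * z))))"
      using on_circle_times[OF _ cont[of vs]] Cons by (simp add: blaschke_factor_def)
    then show ?case by (simp add: mult_ac)
  qed
  then have "blaschke_class \<gamma> ws = on_circle (\<lambda>z. \<gamma> * (\<Prod>w\<leftarrow>ws. (z - w) / (1 - cnj w * z)))"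
    using ws by simp
  also have "\<dots> = on_circle \<alpha>"
    by (intro on_circle_cong) (simp add: \<alpha>)
  finally have "on_circle \<alpha> = blaschke_class \<gamma> ws" by simp
  moreover have "continuous_on (sphere 0 1) \<alpha>"
    using cont[OF ws] by (rule continuous_on_eq) (simp add: \<alpha>)
  moreover have "\<alpha> 0 = \<gamma> * (\<Prod>w\<leftarrow>ws. - w)"
    by (simp add: \<alpha>)
  ultimately show ?thesis
    using that 1 ws by (auto simp: blaschke_data_def)
qed

text \<open>Multipliers \<open>\<theta>\<close> of the Hardy space for which evaluation at \<open>0\<close> is multiplicative, with
  \<open>c\<close> in the role of \<open>\<theta> 0\<close>. This product rule is made part of the notion because it passes to sums
  and products, so that no Fourier series of a product has to be computed.\<close>

definition hardy_multiplier :: "circle_fun \<Rightarrow> complex \<Rightarrow> bool" where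
  "hardy_multiplier \<theta> c \<longleftrightarrow> ess_bounded \<theta> \<and>
     (\<forall>g\<in>H2. \<theta> * g \<in> H2 \<and> \<langle>\<theta> * g, 1\<rangle> = c * \<langle>g, 1\<rangle>)"

lemma hardy_multiplier_scale_1: "hardy_multiplier (c *\<^sub>C 1) c"
  by (simp add: hardy_multiplier_def ess_bounded_scale ess_bounded_1 H2_scale inner_scale_left
      flip: circle_scale_conv)

lemma hardy_multiplier_times:
  "hardy_multiplier \<theta> c \<Longrightarrow> hardy_multiplier \<eta> d \<Longrightarrow> hardy_multiplier (\<theta> * \<eta>) (c * d)"
  by (simp add: hardy_multiplier_def ess_bounded_times mult.assoc)

lemma hardy_multiplier_add:
  "hardy_multiplier \<theta> c \<Longrightarrow> hardy_multiplier \<eta> d \<Longrightarrow> hardy_multiplier (\<theta> + \<eta>) (c + d)"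
  by (simp add: hardy_multiplier_def ess_bounded_add distrib_right H2_add inner_add_left H2_L2 L2_1)

lemma hardy_multiplier_cauchy_kernel: "cmod w < 1 \<Longrightarrow> hardy_multiplier (cauchy_kernel w) 1"
  by (simp add: hardy_multiplier_def ess_bounded_cauchy_kernel H2_cauchy_kernel)

lemma hardy_multiplier_blaschke_factor: "cmod w < 1 \<Longrightarrow> hardy_multiplier (blaschke_factor w) (- w)"
  by (simp add: hardy_multiplier_def ess_bounded_blaschke_factor H2_blaschke_factor)

text \<open>Inner functions as classes on the circle, together with their value at \<open>0\<close>.\<close>

definition inner_class :: "circle_fun \<Rightarrow> complex \<Rightarrow> bool" where
  "inner_class \<theta> c \<longleftrightarrow> hardy_multiplier \<theta> c \<and> circle_cnj \<theta> * \<theta> = 1"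

lemma inner_class_H2: "inner_class \<theta> c \<Longrightarrow> g \<in> H2 \<Longrightarrow> \<theta> * g \<in> H2"
  by (simp add: inner_class_def hardy_multiplier_def)

lemma inner_class_blaschke:
  assumes "blaschke_data \<gamma> ws"
  shows "inner_class (blaschke_class \<gamma> ws) (\<gamma> * (\<Prod>w\<leftarrow>ws. - w))"
  using assms
proof (induction ws)
  case Nil
  then have "\<gamma> * cnj \<gamma> = 1"
    using complex_norm_square[of \<gamma>] by (simp add: blaschke_data_def)
  then show ?case
    using hardy_multiplier_scale_1[of \<gamma>] by (simp add: inner_class_def circle_scale_simps mult.commute)
next
  case (Cons w ws)
  then have w: "cmod w < 1" and IH: "inner_class (blaschke_class \<gamma> ws) (\<gamma> * (\<Prod>w\<leftarrow>ws. - w))"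
    by (auto simp: blaschke_data_def)
  let ?\<theta> = "blaschke_class \<gamma> ws"
  have "circle_cnj (blaschke_factor w) * circle_cnj ?\<theta> * (blaschke_factor w * ?\<theta>) =
      (circle_cnj (blaschke_factor w) * blaschke_factor w) * (circle_cnj ?\<theta> * ?\<theta>)"
    by (simp only: ac_simps)
  also have "\<dots> = 1"
    using IH by (simp add: circle_identities[OF w] inner_class_def)
  finally have "circle_cnj (blaschke_factor w * ?\<theta>) * (blaschke_factor w * ?\<theta>) = 1"
    by simp
  moreover have "hardy_multiplier (blaschke_factor w * ?\<theta>) (- w * (\<gamma> * (\<Prod>w\<leftarrow>ws. - w)))"
    using IH by (intro hardy_multiplier_times hardy_multiplier_blaschke_factor w) (simp add: inner_class_def)
  ultimately show ?case
    by (simp add: inner_class_def mult.left_commute)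
qed

definition model_class :: "circle_fun \<Rightarrow> circle_fun set" where
  "model_class \<theta> = {f \<in> H2. \<forall>g\<in>H2. \<langle>f, \<theta> * g\<rangle> = 0}"

lemma model_H2: "f \<in> model_class \<theta> \<Longrightarrow> f \<in> H2"
  by (simp add: model_class_def)

lemma model_L2: "f \<in> model_class \<theta> \<Longrightarrow> f \<in> L2"
  by (simp add: model_class_def H2_L2)

lemma model_subspace:
  assumes "inner_class \<theta> c" "f \<in> model_class \<theta>" "g \<in> model_class \<theta>"
  shows "f + g \<in> model_class \<theta>" "f - g \<in> model_class \<theta>"
  using assms
  by (auto simp: model_class_def inner_class_H2 H2_add H2_diff inner_add_left inner_diff_left H2_L2)

lemma model_scale: "f \<in> model_class \<theta> \<Longrightarrow> d *\<^sub>C f \<in> model_class \<theta>"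
  by (auto simp: model_class_def H2_scale inner_scale_left)

lemma model_zero: "0 \<in> model_class \<theta>"
  using H2_scale[OF H2_1, of 0] by (simp add: model_class_def)

text \<open>Subtracting a multiple of the Cauchy kernel \<open>E\<close> at \<open>w\<close> makes \<open>f\<close> vanish at \<open>w\<close>, and then it can be
  divided by the Blaschke factor \<open>B\<close>. Together with \<open>cauchy_kernel_model\<close> and
  \<open>blaschke_factor_times_model\<close> this says \<open>K\<^bsub>B \<theta>\<^esub> = span E \<oplus> B K\<^bsub>\<theta>\<^esub>\<close>, which is an orthogonal sum by
  \<open>inner_cauchy_kernel_blaschke_factor\<close>.\<close>

lemma model_decompose:
  assumes \<theta>: "inner_class \<theta> c" and w: "cmod w < 1" and f: "f \<in> model_class (blaschke_factor w * \<theta>)"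
  obtains d k where "k \<in> model_class \<theta>" "f = d *\<^sub>C cauchy_kernel w + blaschke_factor w * k"
proof
  let ?E = "cauchy_kernel w" and ?B = "blaschke_factor w"
  let ?d = "\<langle>f, ?E\<rangle> / \<langle>?E, ?E\<rangle>"
  let ?r = "f - ?d *\<^sub>C ?E"
  have H2: "f \<in> H2" "?E \<in> H2" "?r \<in> H2"
    using f cauchy_kernel_H2[OF w] by (auto simp: model_class_def H2_diff H2_scale)
  have "\<langle>?r, ?E\<rangle> = 0"
    using inner_cauchy_kernel_self[OF w] H2 by (simp add: inner_diff_left H2_L2 L2_scale inner_scale_left)
  then have k: "circle_cnj ?B * ?r \<in> H2"
    using H2_divide_blaschke_factor[OF w] H2 by blast
  have "?B * (circle_cnj ?B * ?r) = (circle_cnj ?B * ?B) * ?r"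
    by (simp only: ac_simps)
  then show "f = ?d *\<^sub>C ?E + ?B * (circle_cnj ?B * ?r)"
    by (simp add: circle_identities[OF w])
  have "\<langle>circle_cnj ?B * ?r, \<theta> * g\<rangle> = 0" if g: "g \<in> H2" for g
  proof -
    have \<theta>g: "\<theta> * g \<in> H2" "?B * (\<theta> * g) \<in> H2"
      using \<theta> g H2_blaschke_factor(1)[OF w] by (auto simp: inner_class_H2)
    have "\<langle>circle_cnj ?B * ?r, \<theta> * g\<rangle> = \<langle>?r, ?B * (\<theta> * g)\<rangle>"
      by (simp add: inner_times_left)
    also have "\<dots> = \<langle>f, ?B * (\<theta> * g)\<rangle> - ?d * \<langle>?E, ?B * (\<theta> * g)\<rangle>"
      using H2 \<theta>g by (simp add: inner_diff_left H2_L2 L2_scale inner_scale_left)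
    also have "\<langle>f, ?B * (\<theta> * g)\<rangle> = 0"
      using f g by (simp add: model_class_def mult.assoc)
    also have "\<langle>?E, ?B * (\<theta> * g)\<rangle> = 0"
      using inner_cauchy_kernel_blaschke_factor[OF w \<theta>g(1)] inner_commute[of ?E] by simp
    finally show ?thesis by simp
  qed
  then show "circle_cnj ?B * ?r \<in> model_class \<theta>"
    using k by (simp add: model_class_def)
qed

lemma cauchy_kernel_model:
  assumes \<theta>: "inner_class \<theta> c" and w: "cmod w < 1"
  shows "cauchy_kernel w \<in> model_class (blaschke_factor w * \<theta>)"
  using inner_cauchy_kernel_blaschke_factor[OF w] inner_commute[of "cauchy_kernel w"] cauchy_kernel_H2[OF w] \<theta>
  by (simp add: model_class_def inner_class_H2 mult.assoc)

lemma blaschke_factor_times_model: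
  assumes w: "cmod w < 1" and k: "k \<in> model_class \<theta>"
  shows "blaschke_factor w * k \<in> model_class (blaschke_factor w * \<theta>)"
proof -
  have "\<langle>blaschke_factor w * k, blaschke_factor w * \<theta> * g\<rangle> = \<langle>k, \<theta> * g\<rangle>" for g
  proof -
    have "circle_cnj (blaschke_factor w) * (blaschke_factor w * \<theta> * g) = (circle_cnj (blaschke_factor w) * blaschke_factor w) * (\<theta> * g)"
      by (simp only: ac_simps)
    then show ?thesis by (simp add: inner_times_left circle_identities[OF w])
  qed
  then show ?thesis
    using k H2_blaschke_factor(1)[OF w] by (simp add: model_class_def)
qed

lemma model_const:
  assumes "cmod \<gamma> = 1" "f \<in> model_class (\<gamma> *\<^sub>C 1)"
  shows "f = 0"
proof -
  have "\<gamma> \<noteq> 0" using assms by auto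
  have f: "f \<in> H2" using assms by (simp add: model_class_def)
  then have "\<langle>f, \<gamma> *\<^sub>C f\<rangle> = 0"
    using assms by (auto simp: model_class_def simp flip: circle_scale_conv)
  then have "\<langle>f, f\<rangle> = 0"
    using \<open>\<gamma> \<noteq> 0\<close> by (simp add: inner_scale_right)
  then show ?thesis
    using f by (intro inner_self_eq_0 H2_L2)
qed

lemma model_multiplier:
  assumes "blaschke_data \<gamma> ws" "f \<in> model_class (blaschke_class \<gamma> ws)"
  shows "\<exists>c. hardy_multiplier f c"
  using assms
proof (induction ws arbitrary: f)
  case Nil
  then have "f = 0 *\<^sub>C 1"
    using model_const by (simp add: blaschke_data_def)
  then show ?case
    using hardy_multiplier_scale_1 by metis
next
  case (Cons w ws)
  then have w: "cmod w < 1" and ws: "blaschke_data \<gamma> ws"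
    and f: "f \<in> model_class (blaschke_factor w * blaschke_class \<gamma> ws)"
    by (auto simp: blaschke_data_def)
  obtain d k where k: "k \<in> model_class (blaschke_class \<gamma> ws)"
    and f: "f = d *\<^sub>C cauchy_kernel w + blaschke_factor w * k"
    using model_decompose[OF inner_class_blaschke[OF ws] w f] .
  obtain c where "hardy_multiplier k c"
    using Cons.IH[OF ws k] by blast
  then have "hardy_multiplier ((d *\<^sub>C 1) * cauchy_kernel w + blaschke_factor w * k) (d * 1 + - w * c)"
    by (intro hardy_multiplier_add hardy_multiplier_times hardy_multiplier_scale_1
      hardy_multiplier_cauchy_kernel hardy_multiplier_blaschke_factor w)
  then show ?case
    unfolding f by (metis circle_scale_conv)
qed

text \<open>Induction on the zeros: the functional is represented separately on the two orthogonal summands of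
  \<open>model_decompose\<close>. This takes the place of completeness of \<open>L2\<close>, both for the existence of the orthogonal
  projection and for adjoints of arbitrary linear operators on the space.\<close>

lemma model_riesz:
  assumes "blaschke_data \<gamma> ws"
    and "\<And>f g. f \<in> model_class (blaschke_class \<gamma> ws) \<Longrightarrow> g \<in> model_class (blaschke_class \<gamma> ws) \<Longrightarrow>
      l (f + g) = l f + l g"
    and "\<And>c f. f \<in> model_class (blaschke_class \<gamma> ws) \<Longrightarrow> l (c *\<^sub>C f) = c * l f"
  shows "\<exists>u\<in>model_class (blaschke_class \<gamma> ws). \<forall>f\<in>model_class (blaschke_class \<gamma> ws). l f = \<langle>f, u\<rangle>"
  using assms
proof (induction ws arbitrary: l)
  case Nil
  have "l 0 = 0"
    using Nil.prems(3)[of 0 0] by (simp add: model_zero)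
  then have "\<forall>f\<in>model_class (blaschke_class \<gamma> []). l f = \<langle>f, 0\<rangle>"
    using Nil.prems(1) model_const[of \<gamma>] by (auto simp: blaschke_data_def)
  then show ?case
    using model_zero by blast
next
  case (Cons w ws)
  then have w: "cmod w < 1" and ws: "blaschke_data \<gamma> ws"
    by (auto simp: blaschke_data_def)
  let ?E = "cauchy_kernel w" and ?B = "blaschke_factor w" and ?\<theta> = "blaschke_class \<gamma> ws"
  note inn = inner_class_blaschke[OF ws] and inn' = inner_class_blaschke[OF Cons.prems(1)]
  note mem = cauchy_kernel_model[OF inn w] blaschke_factor_times_model[OF w, of _ ?\<theta>]
  have "\<exists>u\<in>model_class ?\<theta>. \<forall>f\<in>model_class ?\<theta>. l (?B * f) = \<langle>f, u\<rangle>"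
  proof (rule Cons.IH[OF ws])
    show "l (?B * (f + g)) = l (?B * f) + l (?B * g)" if "f \<in> model_class ?\<theta>" "g \<in> model_class ?\<theta>" for f g
      using that Cons.prems(2)[of "?B * f" "?B * g"] mem by (simp add: distrib_left)
    show "l (?B * (c *\<^sub>C f)) = c * l (?B * f)" if "f \<in> model_class ?\<theta>" for c f
      using that Cons.prems(3)[of "?B * f"] mem by (simp add: circle_scale_simps)
  qed
  then obtain u where u: "u \<in> model_class ?\<theta>" and lu: "\<And>f. f \<in> model_class ?\<theta> \<Longrightarrow> l (?B * f) = \<langle>f, u\<rangle>"
    by blast
  define e where "e = cnj (l ?E / \<langle>?E, ?E\<rangle>)"
  have "l f = \<langle>f, e *\<^sub>C ?E + ?B * u\<rangle>" if f: "f \<in> model_class (?B * ?\<theta>)" for f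
  proof -
    obtain d k where k: "k \<in> model_class ?\<theta>" and f: "f = d *\<^sub>C ?E + ?B * k"
      using model_decompose[OF inn w f] .
    have H2: "?E \<in> H2" "k \<in> H2" "u \<in> H2" "?B * k \<in> H2" "?B * u \<in> H2"
      using cauchy_kernel_H2[OF w] model_H2 k u H2_blaschke_factor(1)[OF w] by auto
    note L2 = H2[THEN H2_L2]
    have "\<langle>?B * k, ?B * u\<rangle> = \<langle>k, (circle_cnj ?B * ?B) * u\<rangle>"
      by (simp add: inner_times_left mult.assoc)
    then have BB: "\<langle>?B * k, ?B * u\<rangle> = \<langle>k, u\<rangle>"
      by (simp add: circle_identities[OF w])
    have "l f = d * l ?E + l (?B * k)"
      using mem k Cons.prems(2)[of "d *\<^sub>C ?E" "?B * k"] Cons.prems(3)[of ?E d] inn'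
      by (simp add: f model_scale)
    also have "\<dots> = d * cnj e * \<langle>?E, ?E\<rangle> + \<langle>k, u\<rangle>"
      using inner_cauchy_kernel_self[OF w] by (simp add: e_def lu[OF k])
    also have "\<dots> = \<langle>f, e *\<^sub>C ?E + ?B * u\<rangle>"
      using inner_cauchy_kernel_blaschke_factor[OF w H2(2)] inner_cauchy_kernel_blaschke_factor[OF w H2(3)]
        inner_commute[of ?E "?B * u"] L2
      by (simp add: f inner_add_left inner_add_right inner_scale_left inner_scale_right L2_add L2_scale BB)
    finally show ?thesis .
  qed
  moreover have "e *\<^sub>C ?E + ?B * u \<in> model_class (?B * ?\<theta>)"
    using inn' mem u by (simp add: model_subspace model_scale)
  ultimately show ?case by auto
qed

section \<open>Operators on a model space\<close>

text \<open>The map \<open>f \<mapsto> (f - f 0) / z\<close>. It is the adjoint of the compressed shift on every model space, and its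
  formula does not depend on the space.\<close>

definition backward_shift :: "circle_fun \<Rightarrow> circle_fun" where
  "backward_shift f = zpow (- 1) * (f - \<langle>f, 1\<rangle> *\<^sub>C 1)"

lemma backward_shift_add:
  "f \<in> L2 \<Longrightarrow> g \<in> L2 \<Longrightarrow> backward_shift (f + g) = backward_shift f + backward_shift g"
  by (simp add: backward_shift_def inner_add_left L2_1 circle_scale_simps right_diff_distrib distrib_left)

lemma backward_shift_scale: "backward_shift (c *\<^sub>C f) = c *\<^sub>C backward_shift f"
  by (simp add: backward_shift_def inner_scale_left circle_scale_simps right_diff_distrib)

lemma backward_shift_L2: "f \<in> L2 \<Longrightarrow> backward_shift f \<in> L2"
  by (simp add: backward_shift_def L2_times ess_bounded_zpow L2_diff L2_scale L2_1)

lemma inner_backward_shift: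
  assumes "f \<in> L2" "g \<in> L2"
  shows "\<langle>backward_shift f, g\<rangle> = \<langle>f, zpow 1 * g\<rangle> - \<langle>f, 1\<rangle> * \<langle>zpow (- 1), g\<rangle>"
proof -
  have "\<langle>backward_shift f, g\<rangle> = \<langle>f - \<langle>f, 1\<rangle> *\<^sub>C 1, zpow 1 * g\<rangle>"
    by (simp add: backward_shift_def inner_times_left)
  also have "\<dots> = \<langle>f, zpow 1 * g\<rangle> - \<langle>f, 1\<rangle> * \<langle>1, zpow 1 * g\<rangle>"
    using assms by (simp add: inner_diff_left L2_scale L2_1 L2_times ess_bounded_zpow inner_scale_left)
  also have "\<langle>1, zpow 1 * g\<rangle> = \<langle>zpow (- 1), g\<rangle>"
    using inner_times_left[of "zpow (- 1)" 1 g] by simp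
  finally show ?thesis .
qed

lemma inner_zpow_neg_H2: "g \<in> H2 \<Longrightarrow> k < 0 \<Longrightarrow> \<langle>zpow k, g\<rangle> = 0"
  using inner_commute[of "zpow k" g] by (simp add: H2_iff)

lemma backward_shift_H2:
  assumes "f \<in> H2"
  shows "backward_shift f \<in> H2"
proof -
  have "\<langle>backward_shift f, zpow k\<rangle> = 0" if "k < 0" for k
  proof (cases "k = - 1")
    case True
    have "\<langle>zpow (- 1), zpow (- 1)\<rangle> = 1"
      using inner_zpow_times[of "- 1" 1 "- 1"] by (simp add: inner_1_1)
    then show ?thesis
      using assms True by (simp add: inner_backward_shift H2_L2 zpow_add)
  next
    case False
    have "\<langle>zpow (- 1), zpow k\<rangle> = 0"
      using inner_zpow_times[of "- 1" 1 k] inner_1_zpow[of "k + 1"] False by simp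
    then show ?thesis
      using assms False that by (simp add: inner_backward_shift H2_L2 zpow_add H2_iff)
  qed
  then show ?thesis
    using assms by (simp add: H2_iff backward_shift_L2)
qed

lemma backward_shift_model:
  assumes \<theta>: "inner_class \<theta> c" and f: "f \<in> model_class \<theta>"
  shows "backward_shift f \<in> model_class \<theta>"
proof -
  have "\<langle>backward_shift f, \<theta> * g\<rangle> = 0" if g: "g \<in> H2" for g
  proof -
    have "\<langle>f, \<theta> * (zpow 1 * g)\<rangle> = 0"
      using f g H2_shift by (auto simp: model_class_def)
    then show ?thesis
      using f g \<theta> by (simp add: inner_backward_shift model_L2 H2_L2 inner_class_H2 inner_zpow_neg_H2 mult.left_commute)
  qed
  then show ?thesis
    using f by (simp add: model_class_def backward_shift_H2)
qed

text \<open>The backward shift has triangular form along the filtration of the model space by the zeros,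
  with diagonal entries \<open>cnj w\<close>: pairing \<open>T f - cnj w f\<close> with \<open>\<theta> g\<close> amounts to pairing \<open>f\<close> with
  \<open>(z - w) \<theta> g = B \<theta> (1 - cnj w z) g\<close>, where \<open>B\<close> is the Blaschke factor at \<open>w\<close>.\<close>

lemma backward_shift_model_Cons:
  assumes \<theta>: "inner_class \<theta> c" and w: "cmod w < 1" and f: "f \<in> model_class (blaschke_factor w * \<theta>)"
  shows "backward_shift f - cnj w *\<^sub>C f \<in> model_class \<theta>"
proof -
  have f2: "f \<in> H2" using f by (rule model_H2)
  have "\<langle>backward_shift f - cnj w *\<^sub>C f, \<theta> * g\<rangle> = 0" if g: "g \<in> H2" for g
  proof -
    \<comment> \<open>\<open>(z - w) \<theta> g\<close> is \<open>B \<theta>\<close> times this function, hence orthogonal to \<open>f\<close>.\<close>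
    define g' where "g' = g - cnj w *\<^sub>C (zpow 1 * g)"
    have g': "g' \<in> H2"
      unfolding g'_def by (intro H2_diff g H2_scale H2_shift)
    have \<theta>g: "\<theta> * g \<in> H2"
      using \<theta> g by (rule inner_class_H2)
    have "blaschke_factor w * \<theta> * g' = (blaschke_factor w * (1 - cnj w *\<^sub>C zpow 1)) * (\<theta> * g)"
      unfolding g'_def by (simp add: algebra_simps circle_scale_simps)
    also have "\<dots> = zpow 1 * (\<theta> * g) - w *\<^sub>C (\<theta> * g)"
      unfolding circle_identities[OF w] by (simp add: left_diff_distrib circle_scale_simps)
    finally have "\<langle>f, zpow 1 * (\<theta> * g) - w *\<^sub>C (\<theta> * g)\<rangle> = 0"
      using f g' by (auto simp: model_class_def)
    then show ?thesis
      using f2 \<theta>g by (simp add: inner_diff_left inner_diff_right inner_backward_shift inner_zpow_neg_H2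
        H2_L2 L2_scale backward_shift_L2 inner_scale_left inner_scale_right L2_times ess_bounded_zpow)
  qed
  then show ?thesis
    using f2 by (simp add: model_class_def backward_shift_H2 H2_diff H2_scale)
qed

lemma model_space_eq: "model_space \<alpha> = model_class (on_circle \<alpha>)"
  by (simp add: model_space_def model_class_def)

lemma model_space_H2: "f \<in> model_space \<alpha> \<Longrightarrow> f \<in> H2"
  by (simp add: model_space_def)

lemma model_space_L2: "f \<in> model_space \<alpha> \<Longrightarrow> f \<in> L2"
  by (simp add: model_space_def H2_L2)

lemma compressed_shift_eq: "compressed_shift \<alpha> h = orth_proj (model_space \<alpha>) (zpow 1 * h)"
  by (simp add: compressed_shift_def zpow_def)

lemma zpow_times_eq_backward_shift: "zpow (- 1) * g = backward_shift g + \<langle>g, 1\<rangle> *\<^sub>C zpow (- 1)"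
  by (simp add: backward_shift_def right_diff_distrib circle_scale_simps)

context
  fixes \<alpha> :: "complex \<Rightarrow> complex" and n :: nat
  assumes \<alpha>: "finite_blaschke \<alpha> n"
begin

private lemmas mem_L2 = model_space_L2[of _ \<alpha>] and mem_H2 = model_space_H2[of _ \<alpha>]

lemma on_circle_inner: "inner_class (on_circle \<alpha>) (\<alpha> 0)"
  using finite_blaschke_class[OF \<alpha>] inner_class_blaschke by metis

lemmas on_circle_times_H2 = inner_class_H2[OF on_circle_inner]

lemma inner_on_circle_times: "g \<in> H2 \<Longrightarrow> \<langle>on_circle \<alpha> * g, 1\<rangle> = \<alpha> 0 * \<langle>g, 1\<rangle>"
  using on_circle_inner by (simp add: inner_class_def hardy_multiplier_def)

lemmas model_space_subspace =
  model_subspace[OF on_circle_inner, folded model_space_eq] model_scale[of _ "on_circle \<alpha>", folded model_space_eq]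

lemma on_circle_cancel: "circle_cnj (on_circle \<alpha>) * (on_circle \<alpha> * g) = g"
  using on_circle_inner unfolding inner_class_def by (metis mult.assoc mult_1)

lemma model_space_multiplier:
  assumes "f \<in> model_space \<alpha>"
  obtains c where "hardy_multiplier f c"
  using assms finite_blaschke_class[OF \<alpha>] model_multiplier unfolding model_space_eq by metis

lemma model_space_bounded: "f \<in> model_space \<alpha> \<Longrightarrow> ess_bounded f"
  using model_space_multiplier unfolding hardy_multiplier_def by metis

lemma model_space_riesz:
  assumes "\<And>f g. f \<in> model_space \<alpha> \<Longrightarrow> g \<in> model_space \<alpha> \<Longrightarrow> l (f + g) = l f + l g"
    and "\<And>c f. f \<in> model_space \<alpha> \<Longrightarrow> l (c *\<^sub>C f) = c * l f"
  obtains u where "u \<in> model_space \<alpha>" "\<And>f. f \<in> model_space \<alpha> \<Longrightarrow> l f = \<langle>f, u\<rangle>"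
proof -
  obtain \<gamma> ws where b: "blaschke_data \<gamma> ws" and eq: "on_circle \<alpha> = blaschke_class \<gamma> ws"
    using finite_blaschke_class[OF \<alpha>] .
  show ?thesis
    using model_riesz[OF b, of l] assms that unfolding model_space_eq eq by blast
qed

lemma model_space_eqI:
  assumes "p \<in> model_space \<alpha>" "q \<in> model_space \<alpha>" "\<And>g. g \<in> model_space \<alpha> \<Longrightarrow> \<langle>p, g\<rangle> = \<langle>q, g\<rangle>"
  shows "p = q"
proof -
  have pq: "p - q \<in> model_space \<alpha>" using assms model_space_subspace by blast
  then have "\<langle>p - q, p - q\<rangle> = 0"
    using assms by (simp add: inner_diff_left mem_L2)
  then have "p - q = 0"
    using pq by (intro inner_self_eq_0 mem_L2)
  then show ?thesis by simp
qed

lemma orth_proj_eqI: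
  assumes "h \<in> L2" "p \<in> model_space \<alpha>" "\<And>g. g \<in> model_space \<alpha> \<Longrightarrow> \<langle>p, g\<rangle> = \<langle>h, g\<rangle>"
  shows "orth_proj (model_space \<alpha>) h = p"
  unfolding orth_proj_def
proof (rule the_equality)
  show "p \<in> model_space \<alpha> \<and> (\<forall>g\<in>model_space \<alpha>. \<langle>h - p, g\<rangle> = 0)"
    using assms by (simp add: inner_diff_left mem_L2)
  show "q = p" if q: "q \<in> model_space \<alpha> \<and> (\<forall>g\<in>model_space \<alpha>. \<langle>h - q, g\<rangle> = 0)" for q
  proof (rule model_space_eqI)
    show "\<langle>q, g\<rangle> = \<langle>p, g\<rangle>" if g: "g \<in> model_space \<alpha>" for g
    proof -
      have "\<langle>h - q, g\<rangle> = 0" using q g by blast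
      then show ?thesis
        using assms q g by (simp add: inner_diff_left mem_L2)
    qed
  qed (use assms q in auto)
qed

lemma orth_proj_model:
  assumes h: "h \<in> L2"
  shows "orth_proj (model_space \<alpha>) h \<in> model_space \<alpha>"
    and "g \<in> model_space \<alpha> \<Longrightarrow> \<langle>orth_proj (model_space \<alpha>) h, g\<rangle> = \<langle>h, g\<rangle>"
proof -
  obtain p where p: "p \<in> model_space \<alpha>" "\<And>g. g \<in> model_space \<alpha> \<Longrightarrow> \<langle>g, h\<rangle> = \<langle>g, p\<rangle>"
    by (rule model_space_riesz[of "\<lambda>g. \<langle>g, h\<rangle>"])
      (use h in \<open>auto simp: inner_add_left inner_scale_left mem_L2\<close>)
  have p2: "\<langle>p, g\<rangle> = \<langle>h, g\<rangle>" if "g \<in> model_space \<alpha>" for g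
    using p(2)[OF that] inner_commute[of p g] inner_commute[of h g] by simp
  have eq: "orth_proj (model_space \<alpha>) h = p"
    using h p(1) p2 by (rule orth_proj_eqI)
  show "orth_proj (model_space \<alpha>) h \<in> model_space \<alpha>"
    and "g \<in> model_space \<alpha> \<Longrightarrow> \<langle>orth_proj (model_space \<alpha>) h, g\<rangle> = \<langle>h, g\<rangle>"
    using p p2 by (simp_all add: eq)
qed

lemma orth_proj_add_diff:
  assumes "f \<in> L2" "g \<in> L2"
  shows "orth_proj (model_space \<alpha>) (f + g) = orth_proj (model_space \<alpha>) f + orth_proj (model_space \<alpha>) g"
    and "orth_proj (model_space \<alpha>) (f - g) = orth_proj (model_space \<alpha>) f - orth_proj (model_space \<alpha>) g"
  using assms
  by (auto intro!: orth_proj_eqI model_space_subspace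
      simp: orth_proj_model inner_add_left inner_diff_left L2_add L2_diff mem_L2)

lemma orth_proj_scale:
  "f \<in> L2 \<Longrightarrow> orth_proj (model_space \<alpha>) (c *\<^sub>C f) = c *\<^sub>C orth_proj (model_space \<alpha>) f"
  by (auto intro!: orth_proj_eqI model_space_subspace simp: orth_proj_model inner_scale_left L2_scale)

lemma L2_norm_orth_proj:
  assumes h: "h \<in> L2"
  shows "L2_norm (orth_proj (model_space \<alpha>) h) \<le> L2_norm h"
proof -
  define p where "p = orth_proj (model_space \<alpha>) h"
  have p: "p \<in> model_space \<alpha>" "\<langle>h, p\<rangle> = \<langle>p, p\<rangle>" "p \<in> L2"
    using orth_proj_model[OF h] by (auto simp: p_def mem_L2)
  then have "\<langle>p, h\<rangle> = \<langle>p, p\<rangle>"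
    using inner_commute[of p h] inner_commute[of p p] by simp
  then have "\<langle>h - p, h - p\<rangle> = \<langle>h, h\<rangle> - \<langle>p, p\<rangle>"
    using h p by (simp add: inner_diff_left inner_diff_right L2_diff)
  moreover have "0 \<le> Re \<langle>h - p, h - p\<rangle>"
    by (simp add: inner_self)
  ultimately show ?thesis
    by (simp add: L2_norm_def p_def)
qed

lemma kernel0_eq: "kernel0 \<alpha> = 1 - cnj (\<alpha> 0) *\<^sub>C on_circle \<alpha>"
proof -
  have "continuous_on (sphere 0 1) \<alpha>"
    using finite_blaschke_class[OF \<alpha>] .
  then show ?thesis
    by (simp add: kernel0_def on_circle_scale on_circle_diff continuous_intros flip: on_circle_1)
qed

lemma conj_kernel0_eq: "conj_kernel0 \<alpha> = backward_shift (on_circle \<alpha>)"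
proof -
  have c: "continuous_on (sphere 0 1) \<alpha>"
    using finite_blaschke_class[OF \<alpha>] .
  have "backward_shift (on_circle \<alpha>) = zpow (- 1) * (on_circle \<alpha> - \<alpha> 0 *\<^sub>C 1)"
    using inner_on_circle_times[OF H2_1] by (simp add: backward_shift_def inner_1_1)
  also have "on_circle \<alpha> - \<alpha> 0 *\<^sub>C 1 = on_circle (\<lambda>z. \<alpha> z - \<alpha> 0)"
    using c by (simp add: on_circle_scale on_circle_diff continuous_intros flip: on_circle_1)
  also have "zpow (- 1) * \<dots> = on_circle (\<lambda>z. z powi (- 1) * (\<alpha> z - \<alpha> 0))"
    unfolding zpow_def using c by (intro on_circle_times continuous_on_zpow continuous_intros)
  also have "\<dots> = conj_kernel0 \<alpha>"
    unfolding conj_kernel0_def by (intro on_circle_cong) (simp add: power_int_minus field_simps)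
  finally show ?thesis by simp
qed

lemma kernel0_model: "kernel0 \<alpha> \<in> model_space \<alpha>"
proof -
  let ?\<theta> = "on_circle \<alpha>"
  have \<theta>: "?\<theta> \<in> H2"
    using on_circle_times_H2[OF H2_1] by simp
  have "\<langle>kernel0 \<alpha>, ?\<theta> * g\<rangle> = 0" if g: "g \<in> H2" for g
  proof -
    have "\<langle>?\<theta>, ?\<theta> * g\<rangle> = \<langle>1, g\<rangle>"
      using inner_times_left[of ?\<theta> 1 "?\<theta> * g"] by (simp add: on_circle_cancel)
    moreover have "\<langle>1, ?\<theta> * g\<rangle> = cnj (\<alpha> 0) * \<langle>1, g\<rangle>"
      using inner_commute[of 1 g] inner_commute[of 1 "?\<theta> * g"] inner_on_circle_times[OF g] by simp
    ultimately show ?thesis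
      using g \<theta> by (simp add: kernel0_eq inner_diff_left inner_scale_left L2_1 L2_scale H2_L2 on_circle_times_H2)
  qed
  then show ?thesis
    using \<theta> by (simp add: model_space_def) (simp add: kernel0_eq H2_diff H2_1 H2_scale)
qed

lemma inner_kernel0:
  assumes "f \<in> model_space \<alpha>"
  shows "\<langle>f, kernel0 \<alpha>\<rangle> = \<langle>f, 1\<rangle>"
proof -
  have "\<langle>f, on_circle \<alpha> * 1\<rangle> = 0"
    using assms H2_1 unfolding model_space_def by blast
  then show ?thesis
    using assms on_circle_times_H2[OF H2_1]
    by (simp add: kernel0_eq inner_diff_right inner_scale_right L2_1 L2_scale H2_L2 mem_L2)
qed

lemma backward_shift_model_space: "f \<in> model_space \<alpha> \<Longrightarrow> backward_shift f \<in> model_space \<alpha>"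
  using backward_shift_model[OF on_circle_inner] by (simp add: model_space_eq)

lemma conj_kernel0_model: "conj_kernel0 \<alpha> \<in> model_space \<alpha>"
proof -
  let ?\<theta> = "on_circle \<alpha>"
  have \<theta>: "?\<theta> \<in> H2"
    using on_circle_times_H2[OF H2_1] by simp
  have "\<langle>backward_shift ?\<theta>, ?\<theta> * g\<rangle> = 0" if g: "g \<in> H2" for g
  proof -
    have "\<langle>?\<theta>, ?\<theta> * (zpow 1 * g)\<rangle> = \<langle>1, zpow 1 * g\<rangle>"
      using inner_times_left[of ?\<theta> 1 "?\<theta> * (zpow 1 * g)"] by (simp add: on_circle_cancel)
    then have "\<langle>?\<theta>, zpow 1 * (?\<theta> * g)\<rangle> = \<langle>1, zpow 1 * g\<rangle>"
      by (simp only: mult.left_commute)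
    also have "\<dots> = \<langle>zpow (- 1), g\<rangle>"
      using inner_times_left[of "zpow (- 1)" 1 g] by simp
    finally show ?thesis
      using g \<theta> by (simp add: inner_backward_shift H2_L2 on_circle_times_H2 inner_zpow_neg_H2)
  qed
  then show ?thesis
    using \<theta> by (simp add: conj_kernel0_eq model_space_def backward_shift_H2)
qed

lemma compressed_shift_model: "h \<in> L2 \<Longrightarrow> compressed_shift \<alpha> h \<in> model_space \<alpha>"
  by (simp add: compressed_shift_eq orth_proj_model L2_times ess_bounded_zpow)

lemma compressed_shift_add_diff:
  assumes "f \<in> L2" "g \<in> L2"
  shows "compressed_shift \<alpha> (f + g) = compressed_shift \<alpha> f + compressed_shift \<alpha> g"
    and "compressed_shift \<alpha> (f - g) = compressed_shift \<alpha> f - compressed_shift \<alpha> g"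
  using assms
  by (simp_all add: compressed_shift_eq distrib_left right_diff_distrib
      orth_proj_add_diff L2_times ess_bounded_zpow)

lemma compressed_shift_scale:
  "f \<in> L2 \<Longrightarrow> compressed_shift \<alpha> (c *\<^sub>C f) = c *\<^sub>C compressed_shift \<alpha> f"
  by (simp add: compressed_shift_eq circle_scale_simps orth_proj_scale L2_times ess_bounded_zpow)

lemma L2_norm_compressed_shift:
  assumes "h \<in> L2"
  shows "L2_norm (compressed_shift \<alpha> h) \<le> L2_norm h"
proof -
  have "\<langle>zpow 1 * h, zpow 1 * h\<rangle> = \<langle>h, (zpow (- 1) * zpow 1) * h\<rangle>"
    by (simp add: inner_times_left mult.assoc)
  then have "L2_norm (zpow 1 * h) = L2_norm h"
    by (simp add: zpow_add L2_norm_def)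
  then show ?thesis
    using L2_norm_orth_proj[of "zpow 1 * h"] assms by (simp add: compressed_shift_eq L2_times ess_bounded_zpow)
qed

lemma compressed_shift_adjoint:
  assumes "f \<in> L2" "g \<in> model_space \<alpha>"
  shows "\<langle>compressed_shift \<alpha> f, g\<rangle> = \<langle>f, zpow (- 1) * g\<rangle>"
  using assms by (simp add: compressed_shift_eq orth_proj_model L2_times ess_bounded_zpow)
    (simp add: inner_times_left)

lemma compressed_shift_adjoint_H2:
  assumes "f \<in> H2" "g \<in> model_space \<alpha>"
  shows "\<langle>compressed_shift \<alpha> f, g\<rangle> = \<langle>f, backward_shift g\<rangle>"
  using assms(1)[unfolded H2_iff] assms(2)
  by (simp add: compressed_shift_adjoint zpow_times_eq_backward_shift inner_add_right inner_scale_right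
      backward_shift_L2 mem_L2 L2_scale)

text \<open>By duality from \<open>T g = g / z - g 0 / z\<close> for \<open>g\<close> in the model space: pairing \<open>h\<close> with \<open>g / z\<close> gives the
  projection of \<open>z h\<close>, and \<open>g 0\<close> is the pairing of \<open>g\<close> with \<open>k\<^sub>0\<close>. The defect found here is the source of one of
  the two rank-one terms; the other one comes from the term \<open>f 0\<close> in the backward shift.\<close>

lemma compressed_shift_orth_proj:
  assumes h: "h \<in> L2"
  shows "compressed_shift \<alpha> (orth_proj (model_space \<alpha>) h) =
    orth_proj (model_space \<alpha>) (zpow 1 * h) - \<langle>h, zpow (- 1)\<rangle> *\<^sub>C kernel0 \<alpha>"
proof (rule model_space_eqI)
  have zh: "zpow 1 * h \<in> L2"
    using h by (simp add: L2_times ess_bounded_zpow)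
  note ph = orth_proj_model[OF h] and pzh = orth_proj_model[OF zh]
  show "compressed_shift \<alpha> (orth_proj (model_space \<alpha>) h) \<in> model_space \<alpha>"
    using ph by (intro compressed_shift_model mem_L2)
  show "orth_proj (model_space \<alpha>) (zpow 1 * h) - \<langle>h, zpow (- 1)\<rangle> *\<^sub>C kernel0 \<alpha> \<in> model_space \<alpha>"
    using pzh kernel0_model by (intro model_space_subspace)
  fix g assume g: "g \<in> model_space \<alpha>"
  have "\<langle>compressed_shift \<alpha> (orth_proj (model_space \<alpha>) h), g\<rangle> = \<langle>h, backward_shift g\<rangle>"
    using ph g by (simp add: compressed_shift_adjoint_H2 mem_H2 backward_shift_model_space)
  moreover have "\<langle>zpow 1 * h, g\<rangle> = \<langle>h, backward_shift g\<rangle> + cnj \<langle>g, 1\<rangle> * \<langle>h, zpow (- 1)\<rangle>"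
    using g h by (simp add: inner_times_left zpow_times_eq_backward_shift inner_add_right inner_scale_right
      backward_shift_L2 mem_L2 L2_scale)
  moreover have "\<langle>kernel0 \<alpha>, g\<rangle> = cnj \<langle>g, 1\<rangle>"
    using inner_commute[of "kernel0 \<alpha>" g] inner_kernel0[OF g] by simp
  ultimately show "\<langle>compressed_shift \<alpha> (orth_proj (model_space \<alpha>) h), g\<rangle> =
      \<langle>orth_proj (model_space \<alpha>) (zpow 1 * h) - \<langle>h, zpow (- 1)\<rangle> *\<^sub>C kernel0 \<alpha>, g\<rangle>"
    using g pzh kernel0_model by (simp add: inner_diff_left inner_scale_left mem_L2 L2_scale)
qed

lemma modified_shift_adjoint:
  assumes g: "g \<in> model_space \<alpha>"
  shows "hilbert_adjoint (model_space \<alpha>) (modified_shift \<alpha> a) g =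
    backward_shift g + (cnj a * \<langle>g, kernel0 \<alpha>\<rangle>) *\<^sub>C conj_kernel0 \<alpha>"
  unfolding hilbert_adjoint_def
proof (rule the_equality)
  let ?h = "backward_shift g + (cnj a * \<langle>g, kernel0 \<alpha>\<rangle>) *\<^sub>C conj_kernel0 \<alpha>"
  note mem = kernel0_model conj_kernel0_model backward_shift_model_space[OF g]
  have adj: "\<langle>modified_shift \<alpha> a f, g\<rangle> = \<langle>f, ?h\<rangle>" if f: "f \<in> model_space \<alpha>" for f
    using f g mem inner_commute[of "kernel0 \<alpha>" g]
    by (simp add: modified_shift_def rank_one_def inner_add_left inner_add_right inner_scale_left
        inner_scale_right mem_L2 L2_scale compressed_shift_model compressed_shift_adjoint_H2 mem_H2)
  show h: "?h \<in> model_space \<alpha> \<and> (\<forall>f\<in>model_space \<alpha>. \<langle>modified_shift \<alpha> a f, g\<rangle> = \<langle>f, ?h\<rangle>)"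
    using adj mem by (auto intro!: model_space_subspace)
  show "q = ?h" if q: "q \<in> model_space \<alpha> \<and> (\<forall>f\<in>model_space \<alpha>. \<langle>modified_shift \<alpha> a f, g\<rangle> = \<langle>f, q\<rangle>)" for q
  proof (rule model_space_eqI)
    show "\<langle>q, f\<rangle> = \<langle>?h, f\<rangle>" if f: "f \<in> model_space \<alpha>" for f
      using q adj[OF f] f inner_commute[of q f] inner_commute[of ?h f] by simp
  qed (use q h in auto)
qed

text \<open>For \<open>u\<close> with value \<open>c\<close> at \<open>0\<close>, the pairing of \<open>cnj u\<close> with \<open>g\<close> is the conjugate of \<open>(u g) 0 = c * g 0\<close>,
  and \<open>k\<^sub>0\<close> reproduces the value at \<open>0\<close>.\<close>

lemma orth_proj_cnj:
  assumes "hardy_multiplier u c"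
  shows "orth_proj (model_space \<alpha>) (circle_cnj u) = cnj c *\<^sub>C kernel0 \<alpha>"
proof (rule orth_proj_eqI)
  show "circle_cnj u \<in> L2"
    using assms by (simp add: hardy_multiplier_def ess_bounded_cnj L2_bounded)
  show "cnj c *\<^sub>C kernel0 \<alpha> \<in> model_space \<alpha>"
    by (intro model_space_subspace kernel0_model)
  fix g assume g: "g \<in> model_space \<alpha>"
  have "\<langle>circle_cnj u, g\<rangle> = \<langle>1, u * g\<rangle>"
    using inner_times_left[of "circle_cnj u" 1 g] by simp
  also have "\<dots> = cnj (c * \<langle>g, kernel0 \<alpha>\<rangle>)"
    using assms g inner_commute[of 1 "u * g"] by (simp add: hardy_multiplier_def mem_H2 inner_kernel0)
  finally show "\<langle>cnj c *\<^sub>C kernel0 \<alpha>, g\<rangle> = \<langle>circle_cnj u, g\<rangle>"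
    using inner_commute[of "kernel0 \<alpha>" g] by (simp add: inner_scale_left)
qed

end

section \<open>Displacement of an operator\<close>

context
  fixes \<alpha> \<beta> :: "complex \<Rightarrow> complex" and m n :: nat
  assumes \<alpha>: "finite_blaschke \<alpha> m" and \<beta>: "finite_blaschke \<beta> n"
begin

private lemmas models_L2 = model_space_L2[of _ \<alpha>] model_space_L2[of _ \<beta>]

lemma linear_operatorsD:
  assumes "A \<in> linear_operators (model_space \<alpha>) (model_space \<beta>)" "f \<in> model_space \<alpha>"
  shows "A f \<in> model_space \<beta>" "A f \<in> L2" "A (c *\<^sub>C f) = c *\<^sub>C A f"
    and "g \<in> model_space \<alpha> \<Longrightarrow> A (f + g) = A f + A g"
  using assms by (auto simp: linear_operators_def intro: PiE_mem model_space_L2[of _ \<beta>])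

text \<open>The modified shifts differ from \<open>S\<close> by a rank-one operator with range spanned by \<open>k\<^sub>0\<close>, so the change of
  \<open>S A S\<^sup>*\<close> consists of terms of the form \<open>v \<otimes> k\<^sub>0\<close> and \<open>k\<^sub>0 \<otimes> u\<close>. The vector \<open>u\<close> is the
  Riesz representative of \<open>f \<mapsto> b \<langle>A T f, k\<rangle>\<close> with \<open>k\<close> the conjugate kernel of \<open>\<beta>\<close>.\<close>

lemma modified_displacement:
  assumes A: "A \<in> linear_operators (model_space \<alpha>) (model_space \<beta>)"
  obtains u v where "u \<in> model_space \<alpha>" "v \<in> model_space \<beta>"
    "\<And>f. f \<in> model_space \<alpha> \<Longrightarrow>
      modified_shift \<beta> b (A (hilbert_adjoint (model_space \<alpha>) (modified_shift \<alpha> a) f)) =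
      compressed_shift \<beta> (A (backward_shift f)) + (rank_one v (kernel0 \<alpha>) f + rank_one (kernel0 \<beta>) u f)"
proof -
  note lin = linear_operatorsD[OF A]
  let ?q = "A (conj_kernel0 \<alpha>)"
  note q = lin(1,2)[OF conj_kernel0_model[OF \<alpha>]]
  note bs = backward_shift_model_space[OF \<alpha>]
  obtain u where u: "u \<in> model_space \<alpha>"
    and uf: "\<And>f. f \<in> model_space \<alpha> \<Longrightarrow> b * \<langle>A (backward_shift f), conj_kernel0 \<beta>\<rangle> = \<langle>f, u\<rangle>"
  proof (rule model_space_riesz[OF \<alpha>, of "\<lambda>f. b * \<langle>A (backward_shift f), conj_kernel0 \<beta>\<rangle>"])
    show "b * \<langle>A (backward_shift (f + g)), conj_kernel0 \<beta>\<rangle> =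
        b * \<langle>A (backward_shift f), conj_kernel0 \<beta>\<rangle> + b * \<langle>A (backward_shift g), conj_kernel0 \<beta>\<rangle>"
      if "f \<in> model_space \<alpha>" "g \<in> model_space \<alpha>" for f g
      using that bs conj_kernel0_model[OF \<beta>]
      by (simp add: backward_shift_add backward_shift_scale models_L2 lin inner_add_left distrib_left)
    show "b * \<langle>A (backward_shift (c *\<^sub>C f)), conj_kernel0 \<beta>\<rangle> = c * (b * \<langle>A (backward_shift f), conj_kernel0 \<beta>\<rangle>)"
      if "f \<in> model_space \<alpha>" for c f
      using that bs by (simp add: backward_shift_add backward_shift_scale models_L2 lin inner_scale_left)
  qed blast
  define v where "v = cnj a *\<^sub>C compressed_shift \<beta> ?q + (cnj a * b * \<langle>?q, conj_kernel0 \<beta>\<rangle>) *\<^sub>C kernel0 \<beta>"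
  have "v \<in> model_space \<beta>"
    unfolding v_def using q
    by (intro model_space_subspace[OF \<beta>] compressed_shift_model[OF \<beta>] kernel0_model[OF \<beta>])
  moreover have "modified_shift \<beta> b (A (hilbert_adjoint (model_space \<alpha>) (modified_shift \<alpha> a) f)) =
      compressed_shift \<beta> (A (backward_shift f)) + (rank_one v (kernel0 \<alpha>) f + rank_one (kernel0 \<beta>) u f)"
    if f: "f \<in> model_space \<alpha>" for f
  proof -
    define e where "e = \<langle>f, kernel0 \<alpha>\<rangle>"
    note Tf = bs[OF f]
    have "A (hilbert_adjoint (model_space \<alpha>) (modified_shift \<alpha> a) f) =
        A (backward_shift f) + (cnj a * e) *\<^sub>C ?q"
      using Tf conj_kernel0_model[OF \<alpha>] model_space_subspace(3)[OF \<alpha> conj_kernel0_model[OF \<alpha>]]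
      by (simp add: modified_shift_adjoint[OF \<alpha> f] e_def lin)
    moreover have "\<langle>A (backward_shift f) + (cnj a * e) *\<^sub>C ?q, conj_kernel0 \<beta>\<rangle> =
        \<langle>A (backward_shift f), conj_kernel0 \<beta>\<rangle> + cnj a * e * \<langle>?q, conj_kernel0 \<beta>\<rangle>"
      using lin(2)[OF Tf] q conj_kernel0_model[OF \<beta>]
      by (simp add: inner_add_left inner_scale_left L2_scale models_L2)
    ultimately show ?thesis
      using lin(2)[OF Tf] q uf[OF f]
      by (simp add: modified_shift_def rank_one_def compressed_shift_add_diff[OF \<beta>] compressed_shift_scale[OF \<beta>] L2_scale v_def
          circle_scale_simps flip: e_def) (simp add: algebra_simps)
  qed
  ultimately show ?thesis
    using that u by blast
qed

text \<open>Since \<open>T f = f / z - f 0 / z\<close>, the product of the symbol with \<open>T f\<close> splits into two parts, and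
  \<open>compressed_shift_orth_proj\<close> applies to each of them.\<close>

lemma toeplitz_displacement:
  assumes \<phi>: "\<phi> \<in> L2" and f: "f \<in> model_space \<alpha>"
  defines "P \<equiv> orth_proj (model_space \<beta>)"
  shows "P (\<phi> * f) - compressed_shift \<beta> (P (\<phi> * backward_shift f)) =
    rank_one (P \<phi> - \<langle>\<phi>, 1\<rangle> *\<^sub>C kernel0 \<beta>) (kernel0 \<alpha>) f +
    rank_one (kernel0 \<beta>) (orth_proj (model_space \<alpha>) (circle_cnj \<phi>)) f"
proof -
  \<comment> \<open>The two parts of \<open>\<phi> T f = h - f 0 k\<close>.\<close>
  define h where "h = zpow (- 1) * (\<phi> * f)"
  define k where "k = zpow (- 1) * \<phi>"
  define e where "e = \<langle>f, 1\<rangle>"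
  have z: "zpow 1 * (zpow (- 1) * g) = g" for g
    by (simp add: zpow_add flip: mult.assoc)
  have "\<phi> * f \<in> L2"
    using L2_times[OF model_space_bounded[OF \<alpha> f] \<phi>] by (simp add: mult.commute)
  then have h: "h \<in> L2" and k: "k \<in> L2"
    using \<phi> by (simp_all add: h_def k_def L2_times ess_bounded_zpow)
  have eq: "\<phi> * backward_shift f = h - e *\<^sub>C k"
    by (simp add: backward_shift_def h_def k_def e_def algebra_simps circle_scale_simps)
  have hin: "\<langle>h, zpow (- 1)\<rangle> = \<langle>f, orth_proj (model_space \<alpha>) (circle_cnj \<phi>)\<rangle>"
  proof -
    have "\<langle>h, zpow (- 1)\<rangle> = \<langle>f, circle_cnj \<phi>\<rangle>"
      by (simp add: h_def inner_times_left zpow_add)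
    also have "\<dots> = \<langle>f, orth_proj (model_space \<alpha>) (circle_cnj \<phi>)\<rangle>"
      using orth_proj_model(2)[OF \<alpha> L2_cnj[OF \<phi>] f] inner_commute[of f] by metis
    finally show ?thesis .
  qed
  have kin: "\<langle>k, zpow (- 1)\<rangle> = \<langle>\<phi>, 1\<rangle>"
    by (simp add: k_def inner_times_left zpow_add)
  have "compressed_shift \<beta> (P (h - e *\<^sub>C k)) = compressed_shift \<beta> (P h) - e *\<^sub>C compressed_shift \<beta> (P k)"
    using h k orth_proj_model(1)[OF \<beta>]
    by (simp add: P_def orth_proj_add_diff[OF \<beta>] orth_proj_scale[OF \<beta>] compressed_shift_add_diff[OF \<beta>] compressed_shift_scale[OF \<beta>] models_L2 L2_scale)
  also have "compressed_shift \<beta> (P h) = P (\<phi> * f) - \<langle>f, orth_proj (model_space \<alpha>) (circle_cnj \<phi>)\<rangle> *\<^sub>C kernel0 \<beta>"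
    unfolding P_def compressed_shift_orth_proj[OF \<beta> h] hin by (simp add: h_def z)
  also have "compressed_shift \<beta> (P k) = P \<phi> - \<langle>\<phi>, 1\<rangle> *\<^sub>C kernel0 \<beta>"
    unfolding P_def compressed_shift_orth_proj[OF \<beta> k] kin by (simp add: k_def z)
  finally show ?thesis
    unfolding eq by (simp add: rank_one_def inner_kernel0[OF \<alpha> f] flip: e_def)
qed

text \<open>A solution of \<open>D = S D T\<close> vanishes: \<open>T\<close> has spectrum in the open disk and \<open>S\<close> is a contraction.
  Quantitatively, if \<open>D\<close> vanishes on the space with one zero \<open>w\<close> fewer, then \<open>D T f = cnj w D f\<close>, hence
  \<open>D f = cnj w S D f\<close>, which has norm at most \<open>cmod w\<close> times the norm of \<open>D f\<close>.\<close>

lemma no_nonzero_shift_invariant: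
  assumes D: "\<And>f. f \<in> model_space \<alpha> \<Longrightarrow> D f \<in> L2"
    and add: "\<And>f g. f \<in> model_space \<alpha> \<Longrightarrow> g \<in> model_space \<alpha> \<Longrightarrow> D (f + g) = D f + D g"
    and scale: "\<And>c f. f \<in> model_space \<alpha> \<Longrightarrow> D (c *\<^sub>C f) = c *\<^sub>C D f"
    and inv: "\<And>f. f \<in> model_space \<alpha> \<Longrightarrow> D f = compressed_shift \<beta> (D (backward_shift f))"
    and f: "f \<in> model_space \<alpha>"
  shows "D f = 0"
proof -
  obtain \<gamma> ws where b: "blaschke_data \<gamma> ws" and eq: "on_circle \<alpha> = blaschke_class \<gamma> ws"
    using finite_blaschke_class[OF \<alpha>] .
  have "D f = 0" if "blaschke_data \<gamma> vs" "model_class (blaschke_class \<gamma> vs) \<subseteq> model_space \<alpha>"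
    "f \<in> model_class (blaschke_class \<gamma> vs)" for vs f
    using that
  proof (induction vs arbitrary: f)
    case Nil
    then have "f = 0"
      using model_const by (simp add: blaschke_data_def)
    then show ?case
      using scale[of f 0] Nil by auto
  next
    case (Cons w vs)
    let ?\<theta> = "blaschke_class \<gamma> vs" and ?B = "blaschke_factor w"
    have w: "cmod w < 1" and vs: "blaschke_data \<gamma> vs"
      using Cons.prems by (auto simp: blaschke_data_def)
    have inn: "inner_class ?\<theta> (\<gamma> * (\<Prod>w\<leftarrow>vs. - w))"
      by (rule inner_class_blaschke[OF vs])
    have f: "f \<in> model_class (?B * ?\<theta>)" "f \<in> model_space \<alpha>"
      using Cons.prems by auto
    have "model_class ?\<theta> \<subseteq> model_class (?B * ?\<theta>)"
      unfolding model_class_def using H2_blaschke_factor(1)[OF w]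
      by (auto simp: mult.assoc mult.left_commute[of ?B])
    then have sub: "model_class ?\<theta> \<subseteq> model_space \<alpha>"
      using Cons.prems(2) by simp
    define g where "g = backward_shift f - cnj w *\<^sub>C f"
    have g: "g \<in> model_class ?\<theta>"
      unfolding g_def using inn w f(1) by (rule backward_shift_model_Cons)
    then have Dg: "D g = 0"
      by (intro Cons.IH[OF vs sub])
    have "backward_shift f = g + cnj w *\<^sub>C f"
      by (simp add: g_def)
    then have "D (backward_shift f) = cnj w *\<^sub>C D f"
      using add[of g "cnj w *\<^sub>C f"] scale f g sub Dg model_space_subspace(3)[OF \<alpha> f(2)] by auto
    then have "D f = cnj w *\<^sub>C compressed_shift \<beta> (D f)"
      using inv[OF f(2)] compressed_shift_scale[OF \<beta> D[OF f(2)], of "cnj w"] by metis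
    then have "\<langle>D f, D f\<rangle> = (w * cnj w) * \<langle>compressed_shift \<beta> (D f), compressed_shift \<beta> (D f)\<rangle>"
      by (metis inner_scale_left inner_scale_right complex_cnj_cnj mult.assoc mult.commute)
    then have "complex_of_real ((L2_norm (D f))\<^sup>2) = of_real ((cmod w)\<^sup>2 * (L2_norm (compressed_shift \<beta> (D f)))\<^sup>2)"
      unfolding inner_self complex_norm_square[symmetric] by simp
    then have "(L2_norm (D f))\<^sup>2 = (cmod w)\<^sup>2 * (L2_norm (compressed_shift \<beta> (D f)))\<^sup>2"
      by (rule of_real_eq_iff[THEN iffD1])
    also have "\<dots> \<le> (cmod w)\<^sup>2 * (L2_norm (D f))\<^sup>2"
      using L2_norm_compressed_shift[OF \<beta> D[OF f(2)]]
      by (intro mult_left_mono power_mono) (auto simp: inner_self)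
    finally have "(1 - (cmod w)\<^sup>2) * (L2_norm (D f))\<^sup>2 \<le> 0"
      by (simp add: algebra_simps)
    moreover have "1 - (cmod w)\<^sup>2 > 0"
      using w by (simp add: power_less_one_iff abs_square_less_1)
    ultimately have "(L2_norm (D f))\<^sup>2 = 0"
      by (simp add: mult_le_0_iff)
    then show ?case
      using D[OF f(2)] by (intro inner_self_eq_0) (auto simp: inner_self)
  qed
  from this[OF b] show ?thesis
    using f by (simp add: model_space_eq eq)
qed

text \<open>The case \<open>a = b = 0\<close>. Conversely to \<open>toeplitz_displacement\<close>, the symbol \<open>\<phi> = v + cnj u\<close> has exactly
  the displacement given by \<open>u\<close> and \<open>v\<close>: its two rank-one terms are formed with \<open>v - v 0 k\<^sub>0\<close> and
  \<open>u + cnj (v 0) k\<^sub>0\<close>, and the contributions of \<open>v 0\<close> cancel. So \<open>A\<close> and the operator with this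
  symbol differ by a solution of \<open>D = S D T\<close>.\<close>

lemma att_operator_iff_displacement:
  assumes A: "A \<in> linear_operators (model_space \<alpha>) (model_space \<beta>)"
  shows "A \<in> att_operators \<alpha> \<beta> \<longleftrightarrow> (\<exists>u\<in>model_space \<alpha>. \<exists>v\<in>model_space \<beta>. \<forall>f\<in>model_space \<alpha>.
    A f - compressed_shift \<beta> (A (backward_shift f)) = rank_one v (kernel0 \<alpha>) f + rank_one (kernel0 \<beta>) u f)"
    (is "_ \<longleftrightarrow> ?rhs")
proof
  assume "A \<in> att_operators \<alpha> \<beta>"
  then obtain \<phi> where \<phi>: "\<phi> \<in> L2" and A\<phi>: "A = att_operator \<alpha> \<beta> \<phi>"
    unfolding att_operators_def by blast
  show ?rhs
  proof (intro bexI ballI)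
    show "orth_proj (model_space \<alpha>) (circle_cnj \<phi>) \<in> model_space \<alpha>"
      using \<phi> by (intro orth_proj_model[OF \<alpha>] L2_cnj)
    show "orth_proj (model_space \<beta>) \<phi> - \<langle>\<phi>, 1\<rangle> *\<^sub>C kernel0 \<beta> \<in> model_space \<beta>"
      using \<phi> by (intro model_space_subspace[OF \<beta>] orth_proj_model[OF \<beta>] kernel0_model[OF \<beta>])
    fix f assume f: "f \<in> model_space \<alpha>"
    then show "A f - compressed_shift \<beta> (A (backward_shift f)) =
      rank_one (orth_proj (model_space \<beta>) \<phi> - \<langle>\<phi>, 1\<rangle> *\<^sub>C kernel0 \<beta>) (kernel0 \<alpha>) f +
      rank_one (kernel0 \<beta>) (orth_proj (model_space \<alpha>) (circle_cnj \<phi>)) f"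
      using toeplitz_displacement[OF \<phi> f] backward_shift_model_space[OF \<alpha> f]
      by (simp add: A\<phi> att_operator_def)
  qed
next
  assume ?rhs
  then obtain u v where u: "u \<in> model_space \<alpha>" and v: "v \<in> model_space \<beta>"
    and disp: "\<And>f. f \<in> model_space \<alpha> \<Longrightarrow> A f - compressed_shift \<beta> (A (backward_shift f)) =
      rank_one v (kernel0 \<alpha>) f + rank_one (kernel0 \<beta>) u f"
    by blast
  define \<phi> where "\<phi> = v + circle_cnj u"
  let ?P = "orth_proj (model_space \<beta>)"
  obtain c d where c: "hardy_multiplier u c" and d: "hardy_multiplier v d"
    using model_space_multiplier[OF \<alpha> u] model_space_multiplier[OF \<beta> v] by metis
  have bdd: "ess_bounded \<phi>"
    using u v by (simp add: \<phi>_def ess_bounded_add ess_bounded_cnj model_space_bounded[OF \<alpha>] model_space_bounded[OF \<beta>])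
  then have \<phi>: "\<phi> \<in> L2"
    by (rule L2_bounded)
  have \<phi>f: "\<phi> * f \<in> L2" if "f \<in> model_space \<alpha>" for f
    using bdd that by (simp add: L2_times models_L2)
  have L2: "u \<in> L2" "v \<in> L2" "circle_cnj u \<in> L2" "circle_cnj v \<in> L2"
    using u v by (simp_all add: L2_cnj models_L2)
  have cd: "\<langle>u, 1\<rangle> = c" "\<langle>v, 1\<rangle> = d"
    using c d H2_1 by (auto simp: hardy_multiplier_def inner_1_1 dest!: bspec[of H2 _ 1])
  have "\<langle>circle_cnj u, 1\<rangle> = cnj c"
    using inner_times_left[of "circle_cnj u" 1 1] inner_commute[of 1 u] cd by simp
  then have \<phi>1: "\<langle>\<phi>, 1\<rangle> = d + cnj c"
    using L2 cd by (simp add: \<phi>_def inner_add_left L2_1)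
  have Pv: "?P v = v" "orth_proj (model_space \<alpha>) u = u"
    using u v by (auto intro!: orth_proj_eqI[OF \<beta>] orth_proj_eqI[OF \<alpha>] simp: models_L2)
  have P\<phi>: "?P \<phi> - \<langle>\<phi>, 1\<rangle> *\<^sub>C kernel0 \<beta> = v - d *\<^sub>C kernel0 \<beta>"
  proof -
    have "?P \<phi> = v + cnj c *\<^sub>C kernel0 \<beta>"
      using L2 by (simp add: \<phi>_def orth_proj_add_diff[OF \<beta>] orth_proj_scale[OF \<beta>] Pv orth_proj_cnj[OF \<beta> c])
    then show ?thesis
      by (simp add: \<phi>1 circle_scale_simps)
  qed
  have P\<phi>': "orth_proj (model_space \<alpha>) (circle_cnj \<phi>) = u + cnj d *\<^sub>C kernel0 \<alpha>"
    using L2 by (simp add: \<phi>_def orth_proj_add_diff[OF \<alpha>] orth_proj_scale[OF \<alpha>] Pv orth_proj_cnj[OF \<alpha> d])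
  have disp\<phi>: "?P (\<phi> * f) - compressed_shift \<beta> (?P (\<phi> * backward_shift f)) =
      rank_one v (kernel0 \<alpha>) f + rank_one (kernel0 \<beta>) u f" if f: "f \<in> model_space \<alpha>" for f
    using toeplitz_displacement[OF \<phi> f] f L2 kernel0_model[OF \<alpha>]
    by (simp add: P\<phi> P\<phi>' rank_one_def inner_add_right inner_scale_right L2_scale models_L2
        circle_scale_simps) (simp add: algebra_simps)
  \<comment> \<open>The difference of the two operators has zero displacement.\<close>
  define D where "D f = A f - ?P (\<phi> * f)" for f
  note lin = linear_operatorsD[OF A]
  have P\<phi>L2: "?P (\<phi> * f) \<in> L2" if "f \<in> model_space \<alpha>" for f
    using orth_proj_model(1)[OF \<beta> \<phi>f[OF that]] by (rule model_space_L2)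
  have "D f = 0" if f: "f \<in> model_space \<alpha>" for f
  proof (rule no_nonzero_shift_invariant[of D, OF _ _ _ _ f])
    fix f assume f: "f \<in> model_space \<alpha>"
    show "D f \<in> L2"
      using lin(2)[OF f] P\<phi>L2[OF f] by (simp add: D_def L2_diff)
    show "D (f + g) = D f + D g" if g: "g \<in> model_space \<alpha>" for g
      using lin(4)[OF f g] \<phi>f f g by (simp add: D_def distrib_left orth_proj_add_diff[OF \<beta>] orth_proj_scale[OF \<beta>])
    show "D (c *\<^sub>C f) = c *\<^sub>C D f" for c
      using lin(3)[OF f] \<phi>f[OF f] by (simp add: D_def circle_scale_simps orth_proj_add_diff[OF \<beta>] orth_proj_scale[OF \<beta>])
    have T: "backward_shift f \<in> model_space \<alpha>"
      by (rule backward_shift_model_space[OF \<alpha> f])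
    have "compressed_shift \<beta> (D (backward_shift f)) =
        compressed_shift \<beta> (A (backward_shift f)) - compressed_shift \<beta> (?P (\<phi> * backward_shift f))"
      unfolding D_def using lin(2)[OF T] P\<phi>L2[OF T] by (rule compressed_shift_add_diff[OF \<beta>])
    then show "D f = compressed_shift \<beta> (D (backward_shift f))"
      using disp[OF f] disp\<phi>[OF f] by (simp add: D_def algebra_simps)
  qed
  then have Af: "A f = ?P (\<phi> * f)" if "f \<in> model_space \<alpha>" for f
    using that by (simp add: D_def)
  moreover have "A \<in> extensional (model_space \<alpha>)"
    using A by (auto simp: linear_operators_def PiE_def)
  ultimately have A\<phi>: "A = att_operator \<alpha> \<beta> \<phi>"
    unfolding att_operator_def by (intro extensionalityI[of _ "model_space \<alpha>"]) auto
  obtain C where C: "\<And>f. f \<in> L2 \<Longrightarrow> L2_norm (\<phi> * f) \<le> C * L2_norm f"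
    using L2_norm_times_le[OF bdd] by blast
  have "L2_norm (A f) \<le> C * L2_norm f" if f: "f \<in> model_space \<alpha>" for f
    using L2_norm_orth_proj[OF \<beta> \<phi>f[OF f]] C[OF model_space_L2[OF f]] by (simp add: Af[OF f])
  then have "bounded_on (model_space \<alpha>) A"
    unfolding bounded_on_def by blast
  then show "A \<in> att_operators \<alpha> \<beta>"
    using \<phi> A\<phi> unfolding att_operators_def by blast
qed

end

theorem theorem3p1:
  fixes \<alpha> \<beta> :: "complex \<Rightarrow> complex" and m n :: nat and a b :: complex
    and A :: "circle_fun \<Rightarrow> circle_fun"
  assumes "finite_blaschke \<alpha> m" and "m > 0"
    and "finite_blaschke \<beta> n" and "n > 0"
    and "A \<in> linear_operators (model_space \<alpha>) (model_space \<beta>)"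
  shows "A \<in> att_operators \<alpha> \<beta> \<longleftrightarrow>
    (\<exists>\<chi>\<^sub>a\<^sub>b \<in> model_space \<alpha>. \<exists>\<psi>\<^sub>a\<^sub>b \<in> model_space \<beta>. \<forall>f \<in> model_space \<alpha>.
       A f - modified_shift \<beta> b (A (hilbert_adjoint (model_space \<alpha>) (modified_shift \<alpha> a) f)) =
       rank_one \<psi>\<^sub>a\<^sub>b (kernel0 \<alpha>) f + rank_one (kernel0 \<beta>) \<chi>\<^sub>a\<^sub>b f)"
proof -
  note \<alpha> = assms(1) and \<beta> = assms(3) and A = assms(5)
  let ?S = "\<lambda>f. compressed_shift \<beta> (A (backward_shift f))"
  let ?M = "\<lambda>f. modified_shift \<beta> b (A (hilbert_adjoint (model_space \<alpha>) (modified_shift \<alpha> a) f))"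
  let ?R = "\<lambda>u v f. rank_one v (kernel0 \<alpha>) f + rank_one (kernel0 \<beta>) u f"
  obtain u\<^sub>0 v\<^sub>0 where u0: "u\<^sub>0 \<in> model_space \<alpha>" and v0: "v\<^sub>0 \<in> model_space \<beta>"
    and M: "\<And>f. f \<in> model_space \<alpha> \<Longrightarrow> ?M f = ?S f + ?R u\<^sub>0 v\<^sub>0 f"
    using modified_displacement[OF \<alpha> \<beta> A] by blast
  have R: "?R (u + u') (v + v') f = ?R u v f + ?R u' v' f" "?R (u - u') (v - v') f = ?R u v f - ?R u' v' f"
    if "u \<in> model_space \<alpha>" "u' \<in> model_space \<alpha>" "f \<in> model_space \<alpha>" for u u' v v' f
    using that by (simp_all add: rank_one_def inner_add_right inner_diff_right model_space_L2[of _ \<alpha>] circle_scale_simps)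
  note sub = model_space_subspace[OF \<alpha>] model_space_subspace[OF \<beta>]
  have "(\<exists>u\<in>model_space \<alpha>. \<exists>v\<in>model_space \<beta>. \<forall>f\<in>model_space \<alpha>. A f - ?S f = ?R u v f) \<longleftrightarrow>
    (\<exists>u\<in>model_space \<alpha>. \<exists>v\<in>model_space \<beta>. \<forall>f\<in>model_space \<alpha>. A f - ?M f = ?R u v f)" (is "?L \<longleftrightarrow> ?L'")
  proof
    assume ?L
    then obtain u v where uv: "u \<in> model_space \<alpha>" "v \<in> model_space \<beta>"
      and eq: "\<And>f. f \<in> model_space \<alpha> \<Longrightarrow> A f - ?S f = ?R u v f"
      by blast
    have "A f - ?M f = ?R (u - u\<^sub>0) (v - v\<^sub>0) f" if f: "f \<in> model_space \<alpha>" for f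
      unfolding R(2)[OF uv(1) u0 f] M[OF f] eq[OF f, symmetric] by simp
    then show ?L'
      using sub(2)[OF uv(1) u0] sub(5)[OF uv(2) v0] by blast
  next
    assume ?L'
    then obtain u v where uv: "u \<in> model_space \<alpha>" "v \<in> model_space \<beta>"
      and eq: "\<And>f. f \<in> model_space \<alpha> \<Longrightarrow> A f - ?M f = ?R u v f"
      by blast
    have "A f - ?S f = ?R (u + u\<^sub>0) (v + v\<^sub>0) f" if f: "f \<in> model_space \<alpha>" for f
      unfolding R(1)[OF uv(1) u0 f] eq[OF f, symmetric] M[OF f] by simp
    then show ?L
      using sub(1)[OF uv(1) u0] sub(4)[OF uv(2) v0] by blast
  qed
  then show ?thesis
    unfolding att_operator_iff_displacement[OF \<alpha> \<beta> A] .
qed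

end
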